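(* Let $F:\mathbb{R}^n\rightrightarrows\mathbb{R}^n$ be a multifunction satisfying (F1)-(F3) of the context, with bilateral minimal time function $T$ and Hamiltonian $h$. Let $(\alpha,\beta)\in\mathbb{R}^n\times\mathbb{R}^n$ be such that $0<r:=T(\alpha,\beta)<+\infty$. Then $$\widehat{\partial}^\infty T(\alpha,\beta)=\widehat{N}_{\mathcal{R}(r)}(\alpha,\beta)\cap\{(\zeta,\theta)\in\mathbb{R}^n\times\mathbb{R}^n: h(\alpha,\zeta)=h(\beta,-\theta)=0\}.$$
   Context: $\|\cdot\|$ and $\langle\cdot,\cdot\rangle$ denote the Euclidean norm and inner product (also on product spaces), and $\bar B$ the closed unit ball of $\mathbb{R}^n$. Assumptions on $F:\mathbb{R}^n\rightrightarrows\mathbb{R}^n$: (F1) $F(x)$ is nonempty, compact and convex for every $x\in\mathbb{R}^n$. (F2) $F$ is locally Lipschitz: for every compact set $K\subset\mathbb{R}^n$ there is a constant $L=L(K)$ such that $F(x)\subset F(y)+L\|y-x\|\bar B$ for all $x,y\in K$. (F3) There are positive constants $\gamma,c$ such that for all $x\in\mathbb{R}^n$, $v\in F(x)$ implies $\|v\|\le\gamma\|x\|+c$. A trajectory of $F$ is an absolutely continuous function $x(\cdot)$ with $\dot x(t)\in F(x(t))$ for a.e. $t$ in its interval of definition. The bilateral minimal time function $T:\mathbb{R}^n\times\mathbb{R}^n\to[0,+\infty]$ is $T(\alpha,\beta)=\inf\{\tau\ge 0:\text{ there is a trajectory }x(\cdot)\text{ of }F\text{ on }[0,\tau]\text{ with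 }x(0)=\alpha,\ x(\tau)=\beta\}$, with $T(\alpha,\beta)=+\infty$ if there is no such trajectory. The Hamiltonian is $h(x,p)=\min_{v\in F(x)}\langle v,p\rangle$ for $(x,p)\in\mathbb{R}^n\times\mathbb{R}^n$. For $t>0$, $\mathcal{R}(t)=\{(x,y)\in\mathbb{R}^n\times\mathbb{R}^n: T(x,y)\le t\}$. For a closed set $S\subset\mathbb{R}^m$ and $x\in S$, the Fréchet normal cone $\widehat{N}_S(x)$ is the set of $\zeta\in\mathbb{R}^m$ with $\limsup_{S\ni y\to x}\frac{\langle\zeta,y-x\rangle}{\|y-x\|}\le 0$, i.e. for every $\varepsilon>0$ there is $\delta>0$ with $\langle\zeta,y-x\rangle\le\varepsilon\|y-x\|$ for all $y\in S$ with $\|y-x\|<\delta$. For $f:\mathbb{R}^m\to\mathbb{R}\cup\{+\infty\}$, $\mathrm{epi}(f)=\{(x,\mu)\in\mathbb{R}^m\times\mathbb{R}: f(x)<+\infty,\ \mu\ge f(x)\}$, and for $x$ with $f(x)<+\infty$ the Fréchet singular subdifferential is $\widehat{\partial}^\infty f(x)=\{\zeta\in\mathbb{R}^m:(\zeta,0)\in\widehat{N}_{\mathrm{epi}(f)}(x,f(x))\}$. *)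

theory Defs
  imports "HOL-Analysis.Analysis"
begin

definition F1 :: "(real^'n \<Rightarrow> (real^'n) set) \<Rightarrow> bool" where
  "F1 F \<longleftrightarrow> (\<forall>x. F x \<noteq> {} \<and> compact (F x) \<and> convex (F x))"

definition F2 :: "(real^'n \<Rightarrow> (real^'n) set) \<Rightarrow> bool" where
  "F2 F \<longleftrightarrow> (\<forall>K. compact K \<longrightarrow> (\<exists>L. \<forall>x\<in>K. \<forall>y\<in>K.
     F x \<subseteq> {v + (L * norm (y - x)) *\<^sub>R b | v b. v \<in> F y \<and> b \<in> cball 0 1}))"

definition F3 :: "(real^'n \<Rightarrow> (real^'n) set) \<Rightarrow> bool" where
  "F3 F \<longleftrightarrow> (\<exists>\<gamma> c. \<gamma> > 0 \<and> c > 0 \<and> (\<forall>x. \<forall>v\<in>F x. norm v \<le> \<gamma> * norm x + c))"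

text \<open>The library constant \<^const>\<open>absolutely_continuous\<close> concerns measures; for functions
  of a real variable we use the usual \<open>\<epsilon>\<close>-\<open>\<delta>\<close> condition over finite families of
  non-overlapping subintervals of the interval \<open>I\<close>.\<close>

definition abs_continuous_on :: "real set \<Rightarrow> (real \<Rightarrow> 'a::real_normed_vector) \<Rightarrow> bool" where
  "abs_continuous_on I x \<longleftrightarrow> (\<forall>\<epsilon>>0. \<exists>\<delta>>0. \<forall>(m::nat) a b.
     (\<forall>i<m. a i \<le> b i \<and> {a i..b i} \<subseteq> I) \<and>
     disjoint_family_on (\<lambda>i. {a i<..<b i}) {..<m} \<and>
     (\<Sum>i<m. b i - a i) < \<delta> \<longrightarrow>
     (\<Sum>i<m. norm (x (b i) - x (a i))) < \<epsilon>)"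

definition trajectory_on ::
  "(real^'n \<Rightarrow> (real^'n) set) \<Rightarrow> real set \<Rightarrow> (real \<Rightarrow> real^'n) \<Rightarrow> bool" where
  "trajectory_on F I x \<longleftrightarrow> abs_continuous_on I x \<and>
     (AE t\<in>I in lebesgue. \<exists>v\<in>F (x t). (x has_vector_derivative v) (at t within I))"

text \<open>The infimum is taken in the extended reals, where \<open>Inf {} = \<infinity>\<close>.\<close>

definition bilateral_min_time ::
  "(real^'n \<Rightarrow> (real^'n) set) \<Rightarrow> (real^'n) \<times> (real^'n) \<Rightarrow> ereal" where
  "bilateral_min_time F = (\<lambda>(\<alpha>, \<beta>).
     Inf {ereal \<tau> | \<tau>. \<tau> \<ge> 0 \<and> (\<exists>x. trajectory_on F {0..\<tau>} x \<and> x 0 = \<alpha> \<and> x \<tau> = \<beta>)})"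

definition hamiltonian :: "(real^'n \<Rightarrow> (real^'n) set) \<Rightarrow> real^'n \<Rightarrow> real^'n \<Rightarrow> real" where
  "hamiltonian F x p = (LEAST m. m \<in> (\<lambda>v. v \<bullet> p) ` F x)"

text \<open>Under \<^const>\<open>F1\<close> the minimum defining the Hamiltonian exists.\<close>

lemma hamiltonian_is_min:
  assumes "F1 F"
  shows "\<exists>v\<in>F x. hamiltonian F x p = v \<bullet> p \<and> (\<forall>w\<in>F x. v \<bullet> p \<le> w \<bullet> p)"
proof -
  have "compact (F x)" "F x \<noteq> {}"
    using assms by (auto simp: F1_def)
  moreover have "continuous_on (F x) (\<lambda>v. v \<bullet> p)"
    by (intro continuous_intros)
  ultimately obtain v where v: "v \<in> F x" "\<forall>w\<in>F x. v \<bullet> p \<le> w \<bullet> p"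
    using continuous_attains_inf by blast
  then have "hamiltonian F x p = v \<bullet> p"
    unfolding hamiltonian_def by (intro Least_equality) auto
  with v show ?thesis by auto
qed

definition reach_set ::
  "(real^'n \<Rightarrow> (real^'n) set) \<Rightarrow> real \<Rightarrow> ((real^'n) \<times> (real^'n)) set" where
  "reach_set F t = {(x, y). bilateral_min_time F (x, y) \<le> ereal t}"

definition frechet_normal_cone :: "'a::euclidean_space set \<Rightarrow> 'a \<Rightarrow> 'a set" where
  "frechet_normal_cone S x = {\<zeta>. \<forall>\<epsilon>>0. \<exists>\<delta>>0. \<forall>y\<in>S.
     norm (y - x) < \<delta> \<longrightarrow> \<zeta> \<bullet> (y - x) \<le> \<epsilon> * norm (y - x)}"

definition epi :: "('a \<Rightarrow> ereal) \<Rightarrow> ('a \<times> real) set" where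
  "epi f = {(x, \<mu>). f x < \<infinity> \<and> f x \<le> ereal \<mu>}"

definition frechet_singular_subdiff :: "('a::euclidean_space \<Rightarrow> ereal) \<Rightarrow> 'a \<Rightarrow> 'a set" where
  "frechet_singular_subdiff f x =
     {\<zeta>. (\<zeta>, 0) \<in> frechet_normal_cone (epi f) (x, real_of_ereal (f x))}"

end

theory Submission
  imports Defs "HOL-Complex_Analysis.Great_Picard"
begin

text \<open>
  The Hamiltonian controls short arcs: a trajectory of length \<open>t\<close> from \<open>x\<close> near \<open>\<alpha>\<close> to \<open>m\<close> satisfies
  \<open>\<zeta> \<bullet> (m - x) \<ge> t * (h \<alpha> \<zeta> - O(\<bar>x - \<alpha>\<bar> + t))\<close>. If \<open>T(x, y) \<le> \<mu>\<close> with \<open>\<mu> > r\<close>, cutting off an initial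
  arc of length at most \<open>2 * (\<mu> - r)\<close> of an almost optimal trajectory moves \<open>(x, y)\<close> into the
  reachable set at the cost of a second-order term as soon as \<open>h \<alpha> \<zeta> \<ge> 0\<close>, so normals to the
  reachable set become horizontal normals to the epigraph. Conversely, testing a horizontal normal
  against the initial arcs of almost optimal trajectories gives \<open>h \<alpha> \<zeta> \<le> 0\<close>, and testing it
  against arcs that arrive at \<open>\<alpha>\<close> with a prescribed velocity gives \<open>h \<alpha> \<zeta> \<ge> 0\<close>. Such arcs exist by
  Peano's theorem for the continuous selection \<open>x \<mapsto> closest_point (F x) v\<close>. Reversing time, which
  replaces \<open>F\<close> by \<open>- F\<close>, yields the condition at \<open>\<beta>\<close>.
\<close>

subsection \<open>Absolutely continuous functions\<close>

lemma abs_continuous_on_subset: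
  assumes "abs_continuous_on I x" "J \<subseteq> I"
  shows "abs_continuous_on J x"
  unfolding abs_continuous_on_def
proof (intro allI impI)
  fix e :: real assume "e > 0"
  then obtain d where d: "d > 0" "\<And>(m::nat) a b.
     (\<forall>i<m. a i \<le> b i \<and> {a i..b i} \<subseteq> I) \<and> disjoint_family_on (\<lambda>i. {a i<..<b i}) {..<m} \<and>
     (\<Sum>i<m. b i - a i) < d \<Longrightarrow> (\<Sum>i<m. norm (x (b i) - x (a i))) < e"
    using assms(1) unfolding abs_continuous_on_def by meson
  show "\<exists>d>0. \<forall>(m::nat) a b. (\<forall>i<m. a i \<le> b i \<and> {a i..b i} \<subseteq> J) \<and>
     disjoint_family_on (\<lambda>i. {a i<..<b i}) {..<m} \<and> (\<Sum>i<m. b i - a i) < d \<longrightarrow>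
     (\<Sum>i<m. norm (x (b i) - x (a i))) < e"
  proof (intro exI conjI allI impI)
    show "d > 0" by fact
    fix m :: nat and a b :: "nat \<Rightarrow> real"
    assume H: "(\<forall>i<m. a i \<le> b i \<and> {a i..b i} \<subseteq> J) \<and>
     disjoint_family_on (\<lambda>i. {a i<..<b i}) {..<m} \<and> (\<Sum>i<m. b i - a i) < d"
    show "(\<Sum>i<m. norm (x (b i) - x (a i))) < e"
      using H assms(2) by (intro d(2)) blast
  qed
qed

lemma abs_continuous_on_cong:
  assumes "\<And>t. t \<in> I \<Longrightarrow> x t = y t"
  shows "abs_continuous_on I x \<longleftrightarrow> abs_continuous_on I y"
proof -
  have *: "abs_continuous_on I y"
    if ac: "abs_continuous_on I x" and eq: "\<And>t. t \<in> I \<Longrightarrow> x t = y t" for x y :: "real \<Rightarrow> 'a"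
    unfolding abs_continuous_on_def
  proof (intro allI impI)
    fix e :: real assume "e > 0"
    then obtain d where d: "d > 0" "\<And>(m::nat) a b.
       (\<forall>i<m. a i \<le> b i \<and> {a i..b i} \<subseteq> I) \<and> disjoint_family_on (\<lambda>i. {a i<..<b i}) {..<m} \<and>
       (\<Sum>i<m. b i - a i) < d \<Longrightarrow> (\<Sum>i<m. norm (x (b i) - x (a i))) < e"
      using ac unfolding abs_continuous_on_def by meson
    show "\<exists>d>0. \<forall>(m::nat) a b. (\<forall>i<m. a i \<le> b i \<and> {a i..b i} \<subseteq> I) \<and>
       disjoint_family_on (\<lambda>i. {a i<..<b i}) {..<m} \<and> (\<Sum>i<m. b i - a i) < d \<longrightarrow>
       (\<Sum>i<m. norm (y (b i) - y (a i))) < e"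
    proof (intro exI conjI allI impI)
      show "d > 0" by fact
      fix m :: nat and a b :: "nat \<Rightarrow> real"
      assume H: "(\<forall>i<m. a i \<le> b i \<and> {a i..b i} \<subseteq> I) \<and>
       disjoint_family_on (\<lambda>i. {a i<..<b i}) {..<m} \<and> (\<Sum>i<m. b i - a i) < d"
      have "(\<Sum>i<m. norm (y (b i) - y (a i))) = (\<Sum>i<m. norm (x (b i) - x (a i)))"
      proof (rule sum.cong)
        fix i assume "i \<in> {..<m}"
        then have "a i \<in> {a i..b i}" "b i \<in> {a i..b i}" "{a i..b i} \<subseteq> I" using H by auto
        then show "norm (y (b i) - y (a i)) = norm (x (b i) - x (a i))"
          using eq by (metis subsetD)
      qed simp
      then show "(\<Sum>i<m. norm (y (b i) - y (a i))) < e" using d(2)[OF H] by simp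
    qed
  qed
  show ?thesis using *[of x y] *[of y x] assms by metis
qed

lemma lipschitz_imp_abs_continuous_on:
  assumes "\<And>s t. s \<in> I \<Longrightarrow> t \<in> I \<Longrightarrow> norm (x s - x t) \<le> L * \<bar>s - t\<bar>"
  shows "abs_continuous_on I x"
  unfolding abs_continuous_on_def
proof (intro allI impI)
  fix e :: real assume "e > 0"
  show "\<exists>d>0. \<forall>(m::nat) a b. (\<forall>i<m. a i \<le> b i \<and> {a i..b i} \<subseteq> I) \<and>
     disjoint_family_on (\<lambda>i. {a i<..<b i}) {..<m} \<and> (\<Sum>i<m. b i - a i) < d \<longrightarrow>
     (\<Sum>i<m. norm (x (b i) - x (a i))) < e"
  proof (intro exI conjI allI impI)
    show "e / (\<bar>L\<bar> + 1) > 0" using \<open>e > 0\<close> by simp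
    fix m :: nat and a b :: "nat \<Rightarrow> real"
    assume H: "(\<forall>i<m. a i \<le> b i \<and> {a i..b i} \<subseteq> I) \<and>
     disjoint_family_on (\<lambda>i. {a i<..<b i}) {..<m} \<and> (\<Sum>i<m. b i - a i) < e / (\<bar>L\<bar> + 1)"
    have "(\<Sum>i<m. norm (x (b i) - x (a i))) \<le> (\<Sum>i<m. (\<bar>L\<bar> + 1) * (b i - a i))"
    proof (rule sum_mono)
      fix i assume "i \<in> {..<m}"
      then have i: "a i \<le> b i" "{a i..b i} \<subseteq> I" using H by auto
      have "norm (x (b i) - x (a i)) \<le> L * \<bar>b i - a i\<bar>"
        using i by (intro assms) auto
      also have "\<dots> \<le> (\<bar>L\<bar> + 1) * (b i - a i)"
        using i by (auto intro!: mult_right_mono)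
      finally show "norm (x (b i) - x (a i)) \<le> (\<bar>L\<bar> + 1) * (b i - a i)" .
    qed
    also have "\<dots> = (\<bar>L\<bar> + 1) * (\<Sum>i<m. b i - a i)" by (rule sum_distrib_left[symmetric])
    also have "\<dots> < e"
      using H by (simp add: pos_less_divide_eq mult.commute add_pos_nonneg)
    finally show "(\<Sum>i<m. norm (x (b i) - x (a i))) < e" .
  qed
qed

lemma abs_continuous_on_imp_continuous_on:
  assumes "abs_continuous_on {a..b} x"
  shows "continuous_on {a..b} x"
  unfolding continuous_on_iff
proof (intro ballI allI impI)
  fix t and e :: real assume t: "t \<in> {a..b}" and "e > 0"
  then obtain d where d: "d > 0" "\<And>(m::nat) u v.
     (\<forall>i<m. u i \<le> v i \<and> {u i..v i} \<subseteq> {a..b}) \<and> disjoint_family_on (\<lambda>i. {u i<..<v i}) {..<m} \<and>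
     (\<Sum>i<m. v i - u i) < d \<Longrightarrow> (\<Sum>i<m. norm (x (v i) - x (u i))) < e"
    using assms unfolding abs_continuous_on_def by meson
  show "\<exists>d>0. \<forall>s\<in>{a..b}. dist s t < d \<longrightarrow> dist (x s) (x t) < e"
  proof (intro exI conjI ballI impI)
    fix s assume s: "s \<in> {a..b}" "dist s t < d"
    have "norm (x (max s t) - x (min s t)) < e"
      using d(2)[of 1 "\<lambda>_. min s t" "\<lambda>_. max s t"] s t
      by (auto simp: disjoint_family_on_def dist_real_def max_def min_def split: if_splits)
    then show "dist (x s) (x t) < e"
      by (auto simp: dist_norm max_def min_def norm_minus_commute split: if_splits)
  qed fact
qed

text \<open>Tagged divisions are finite sets of pairs, whereas the definition indexes its families
  by an initial segment of the naturals. A bijection with such a segment carries the bound over,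
  with one \<open>d\<close> for all families.\<close>

lemma abs_continuous_on_finite_family:
  fixes x :: "real \<Rightarrow> 'a::real_normed_vector"
  assumes "abs_continuous_on I x" "e > 0"
  shows "\<exists>d>0. \<forall>Q (a::'i \<Rightarrow> real) b. finite Q \<longrightarrow>
     (\<forall>i\<in>Q. a i \<le> b i \<and> {a i..b i} \<subseteq> I) \<longrightarrow>
     disjoint_family_on (\<lambda>i. {a i<..<b i}) Q \<longrightarrow> (\<Sum>i\<in>Q. b i - a i) < d \<longrightarrow>
     (\<Sum>i\<in>Q. norm (x (b i) - x (a i))) < e"
proof -
  obtain d where d: "d > 0" "\<And>(m::nat) u v.
     (\<forall>i<m. u i \<le> v i \<and> {u i..v i} \<subseteq> I) \<and> disjoint_family_on (\<lambda>i. {u i<..<v i}) {..<m} \<and>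
     (\<Sum>i<m. v i - u i) < d \<Longrightarrow> (\<Sum>i<m. norm (x (v i) - x (u i))) < e"
    using assms unfolding abs_continuous_on_def by meson
  show ?thesis
  proof (intro exI conjI allI impI)
    show "d > 0" by fact
    fix Q and a b :: "'i \<Rightarrow> real"
    assume Q: "finite Q" "\<forall>i\<in>Q. a i \<le> b i \<and> {a i..b i} \<subseteq> I"
      "disjoint_family_on (\<lambda>i. {a i<..<b i}) Q" "(\<Sum>i\<in>Q. b i - a i) < d"
    obtain f where f: "bij_betw f {..<card Q} Q"
      using ex_bij_betw_nat_finite[OF Q(1)] by (auto simp: atLeast0LessThan)
    then have inQ: "f i \<in> Q" if "i < card Q" for i
      using that by (auto simp: bij_betw_def)
    have inj: "f i \<noteq> f j" if "i < card Q" "j < card Q" "i \<noteq> j" for i j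
      using f that by (auto simp: bij_betw_def inj_on_def)
    have re: "(\<Sum>i\<in>Q. g i) = (\<Sum>i<card Q. g (f i))" for g :: "'i \<Rightarrow> real"
      using sum.reindex_bij_betw[OF f, of g] by simp
    show "(\<Sum>i\<in>Q. norm (x (b i) - x (a i))) < e"
      unfolding re
    proof (rule d(2)[of "card Q" "\<lambda>i. a (f i)" "\<lambda>i. b (f i)"], intro conjI allI impI)
      show "disjoint_family_on (\<lambda>i. {a (f i)<..<b (f i)}) {..<card Q}"
        using Q(3) inQ inj unfolding disjoint_family_on_def by (metis lessThan_iff)
      show "(\<Sum>i<card Q. b (f i) - a (f i)) < d" using Q(4) re by simp
    qed (use Q(2) inQ in auto)
  qed
qed

lemma disjoint_family_on_mono:
  assumes "disjoint_family_on A I" "\<And>i. i \<in> I \<Longrightarrow> B i \<subseteq> A i"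
  shows "disjoint_family_on B I"
  using assms unfolding disjoint_family_on_def by blast

text \<open>Clamping endpoints with \<open>min _ c\<close> and \<open>max _ c\<close> cuts every
  interval at \<open>c\<close>. The pieces stay disjoint and do not get longer, so each side is
  controlled by its own half of \<open>e\<close>.\<close>

lemma abs_continuous_on_combine:
  assumes "abs_continuous_on {a..c} x" "abs_continuous_on {c..b} x"
  shows "abs_continuous_on {a..b} x"
  unfolding abs_continuous_on_def
proof (intro allI impI)
  fix e :: real assume "e > 0"
  then have e2: "e / 2 > 0" by simp
  obtain d1 where d1: "d1 > 0" "\<And>(m::nat) u v.
     (\<forall>i<m. u i \<le> v i \<and> {u i..v i} \<subseteq> {a..c}) \<and> disjoint_family_on (\<lambda>i. {u i<..<v i}) {..<m} \<and>
     (\<Sum>i<m. v i - u i) < d1 \<Longrightarrow> (\<Sum>i<m. norm (x (v i) - x (u i))) < e / 2"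
    using assms(1) e2 unfolding abs_continuous_on_def by meson
  obtain d2 where d2: "d2 > 0" "\<And>(m::nat) u v.
     (\<forall>i<m. u i \<le> v i \<and> {u i..v i} \<subseteq> {c..b}) \<and> disjoint_family_on (\<lambda>i. {u i<..<v i}) {..<m} \<and>
     (\<Sum>i<m. v i - u i) < d2 \<Longrightarrow> (\<Sum>i<m. norm (x (v i) - x (u i))) < e / 2"
    using assms(2) e2 unfolding abs_continuous_on_def by meson
  show "\<exists>d>0. \<forall>(m::nat) u v. (\<forall>i<m. u i \<le> v i \<and> {u i..v i} \<subseteq> {a..b}) \<and>
     disjoint_family_on (\<lambda>i. {u i<..<v i}) {..<m} \<and> (\<Sum>i<m. v i - u i) < d \<longrightarrow>
     (\<Sum>i<m. norm (x (v i) - x (u i))) < e"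
  proof (intro exI conjI allI impI)
    show "min d1 d2 > 0" using d1 d2 by simp
    fix m :: nat and u v :: "nat \<Rightarrow> real"
    assume H: "(\<forall>i<m. u i \<le> v i \<and> {u i..v i} \<subseteq> {a..b}) \<and>
     disjoint_family_on (\<lambda>i. {u i<..<v i}) {..<m} \<and> (\<Sum>i<m. v i - u i) < min d1 d2"
    then have uv: "u i \<le> v i" "a \<le> u i" "v i \<le> b" if "i < m" for i
      using that by (auto simp: atLeastatMost_subset_iff)
    have "(\<Sum>i<m. norm (x (v i) - x (u i))) \<le>
        (\<Sum>i<m. norm (x (min (v i) c) - x (min (u i) c)) + norm (x (max (v i) c) - x (max (u i) c)))"
    proof (rule sum_mono)
      fix i assume "i \<in> {..<m}"
      then have "u i \<le> v i" using uv by auto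
      then show "norm (x (v i) - x (u i)) \<le>
          norm (x (min (v i) c) - x (min (u i) c)) + norm (x (max (v i) c) - x (max (u i) c))"
        using norm_triangle_ineq[of "x c - x (u i)" "x (v i) - x c"]
        by (auto simp: min_def max_def)
    qed
    also have "\<dots> = (\<Sum>i<m. norm (x (min (v i) c) - x (min (u i) c))) +
        (\<Sum>i<m. norm (x (max (v i) c) - x (max (u i) c)))"
      by (rule sum.distrib)
    also have "\<dots> < e / 2 + e / 2"
    proof (rule add_strict_mono)
      show "(\<Sum>i<m. norm (x (min (v i) c) - x (min (u i) c))) < e / 2"
      proof (cases "a \<le> c")
        case True
        show ?thesis
        proof (rule d1(2), intro conjI allI impI)
          fix i assume "i < m"
          then show "min (u i) c \<le> min (v i) c" "{min (u i) c..min (v i) c} \<subseteq> {a..c}"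
            using uv[of i] True by auto
        next
          show "disjoint_family_on (\<lambda>i. {min (u i) c<..<min (v i) c}) {..<m}"
            by (rule disjoint_family_on_mono[OF conjunct1[OF conjunct2[OF H]]]) auto
          have "(\<Sum>i<m. min (v i) c - min (u i) c) \<le> (\<Sum>i<m. v i - u i)"
            using uv by (intro sum_mono) (smt (verit) lessThan_iff)
          then show "(\<Sum>i<m. min (v i) c - min (u i) c) < d1" using H by simp
        qed
      next
        case False
        \<comment> \<open>Here \<open>c < a\<close>, so every interval lies to the right of
          \<open>c\<close> and its left piece degenerates to the point \<open>c\<close>.\<close>
        have "min (v i) c = min (u i) c" if "i < m" for i
          using uv[OF that] False by (simp add: min_def)
        then show ?thesis using e2 by simp
      qed
      show "(\<Sum>i<m. norm (x (max (v i) c) - x (max (u i) c))) < e / 2"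
      proof (cases "c \<le> b")
        case True
        show ?thesis
        proof (rule d2(2), intro conjI allI impI)
          fix i assume "i < m"
          then show "max (u i) c \<le> max (v i) c" "{max (u i) c..max (v i) c} \<subseteq> {c..b}"
            using uv[of i] True by auto
        next
          show "disjoint_family_on (\<lambda>i. {max (u i) c<..<max (v i) c}) {..<m}"
            by (rule disjoint_family_on_mono[OF conjunct1[OF conjunct2[OF H]]]) auto
          have "(\<Sum>i<m. max (v i) c - max (u i) c) \<le> (\<Sum>i<m. v i - u i)"
            using uv by (intro sum_mono) (smt (verit) lessThan_iff)
          then show "(\<Sum>i<m. max (v i) c - max (u i) c) < d2" using H by simp
        qed
      next
        case False
        have "max (v i) c = max (u i) c" if "i < m" for i
          using uv[OF that] False by (simp add: max_def)
        then show ?thesis using e2 by simp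
      qed
    qed
    finally show "(\<Sum>i<m. norm (x (v i) - x (u i))) < e" by simp
  qed
qed

lemma abs_continuous_on_reflect:
  assumes "abs_continuous_on {a..b} x"
  shows "abs_continuous_on {c - b..c - a} (\<lambda>t. x (c - t))"
  unfolding abs_continuous_on_def
proof (intro allI impI)
  fix e :: real assume "e > 0"
  then obtain d where d: "d > 0" "\<And>(m::nat) u v.
     (\<forall>i<m. u i \<le> v i \<and> {u i..v i} \<subseteq> {a..b}) \<and> disjoint_family_on (\<lambda>i. {u i<..<v i}) {..<m} \<and>
     (\<Sum>i<m. v i - u i) < d \<Longrightarrow> (\<Sum>i<m. norm (x (v i) - x (u i))) < e"
    using assms unfolding abs_continuous_on_def by meson
  show "\<exists>d>0. \<forall>(m::nat) u v. (\<forall>i<m. u i \<le> v i \<and> {u i..v i} \<subseteq> {c - b..c - a}) \<and>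
     disjoint_family_on (\<lambda>i. {u i<..<v i}) {..<m} \<and> (\<Sum>i<m. v i - u i) < d \<longrightarrow>
     (\<Sum>i<m. norm (x (c - v i) - x (c - u i))) < e"
  proof (intro exI conjI allI impI)
    show "d > 0" by fact
    fix m :: nat and u v :: "nat \<Rightarrow> real"
    assume H: "(\<forall>i<m. u i \<le> v i \<and> {u i..v i} \<subseteq> {c - b..c - a}) \<and>
     disjoint_family_on (\<lambda>i. {u i<..<v i}) {..<m} \<and> (\<Sum>i<m. v i - u i) < d"
    have "(\<Sum>i<m. norm (x (c - u i) - x (c - v i))) < e"
    proof (rule d(2), intro conjI)
      show "disjoint_family_on (\<lambda>i. {c - v i<..<c - u i}) {..<m}"
        unfolding disjoint_family_on_def
      proof (intro ballI impI equals0I)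
        fix i j t assume ij: "i \<in> {..<m}" "j \<in> {..<m}" "i \<noteq> j"
          "t \<in> {c - v i<..<c - u i} \<inter> {c - v j<..<c - u j}"
        then have "c - t \<in> {u i<..<v i} \<inter> {u j<..<v j}" by auto
        then show False using H ij unfolding disjoint_family_on_def by blast
      qed
    qed (use H in \<open>auto simp: atLeastatMost_subset_iff\<close>)
    then show "(\<Sum>i<m. norm (x (c - v i) - x (c - u i))) < e"
      by (simp add: norm_minus_commute)
  qed
qed

section \<open>Increment bounds from almost everywhere derivative bounds\<close>

text \<open>An explicit null set can be covered by a small open set, mapped by a reflection, or
  enlarged by finitely many points; the later arguments do all three.\<close>

lemma AE_subset_lebesgue_iff:
  "(AE t\<in>I in lebesgue. P t) \<longleftrightarrow> (\<exists>N. negligible N \<and> (\<forall>t\<in>I - N. P t))"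
proof
  assume "AE t\<in>I in lebesgue. P t"
  then obtain N where "N \<in> null_sets lebesgue" "{t \<in> space lebesgue. \<not> (t \<in> I \<longrightarrow> P t)} \<subseteq> N"
    unfolding eventually_ae_filter by blast
  then show "\<exists>N. negligible N \<and> (\<forall>t\<in>I - N. P t)"
    unfolding negligible_iff_null_sets by (intro exI[of _ N]) auto
next
  assume "\<exists>N. negligible N \<and> (\<forall>t\<in>I - N. P t)"
  then obtain N where "N \<in> null_sets lebesgue" "\<forall>t\<in>I - N. P t"
    unfolding negligible_iff_null_sets by blast
  then show "AE t\<in>I in lebesgue. P t"
    by (intro AE_I'[of N]) auto
qed

text \<open>Off the exceptional null set, a fine tagged division makes every increment almost linear in
  the length of the interval; the intervals tagged in the null set lie in an open set of small
  measure, where absolute continuity bounds the total increment.\<close>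

lemma abs_continuous_inner_increment_le:
  fixes x :: "real \<Rightarrow> 'a::real_inner"
  assumes "a \<le> b" and ac: "abs_continuous_on {a..b} x"
    and ae: "AE t\<in>{a..b} in lebesgue.
      \<exists>v. (x has_vector_derivative v) (at t within {a..b}) \<and> p \<bullet> v \<le> M"
  shows "p \<bullet> (x b - x a) \<le> M * (b - a)"
proof -
  obtain N where N: "negligible N" "\<And>t. t \<in> {a..b} - N \<Longrightarrow>
      \<exists>v. (x has_vector_derivative v) (at t within {a..b}) \<and> p \<bullet> v \<le> M"
    using ae unfolding AE_subset_lebesgue_iff by blast
  \<comment> \<open>The error has three sources: \<open>norm p * e\<close> from the intervals tagged
    in \<open>N\<close>, \<open>norm p * e * (b - a)\<close> from the linearization on the others,
    and \<open>e\<close> for the length that the former take away from the latter.\<close>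
  have bound: "p \<bullet> (x b - x a) \<le> M * (b - a) + e * (1 + norm p * (1 + b - a))"
    if "e > 0" for e :: real
  proof -
    from abs_continuous_on_finite_family[OF ac \<open>e > 0\<close>, where 'i = "real \<times> real set"]
    obtain d0 where d0: "d0 > 0" "\<forall>Q (u::real \<times> real set \<Rightarrow> real) v. finite Q \<longrightarrow>
       (\<forall>i\<in>Q. u i \<le> v i \<and> {u i..v i} \<subseteq> {a..b}) \<longrightarrow>
       disjoint_family_on (\<lambda>i. {u i<..<v i}) Q \<longrightarrow> (\<Sum>i\<in>Q. v i - u i) < d0 \<longrightarrow>
       (\<Sum>i\<in>Q. norm (x (v i) - x (u i))) < e"
      by (elim exE conjE) (rule that)
    \<comment> \<open>The second bound gives \<open>\<bar>M\<bar> * d \<le> e\<close>, which pays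
      for the missing length of the intervals tagged in \<open>N\<close>.\<close>
    define d where "d = min d0 (e / (\<bar>M\<bar> + 1))"
    have d: "d > 0" "d \<le> d0" "\<bar>M\<bar> * d \<le> e"
    proof -
      show "d > 0" "d \<le> d0" using d0(1) \<open>e > 0\<close> by (auto simp: d_def)
      have "\<bar>M\<bar> * d \<le> (\<bar>M\<bar> + 1) * (e / (\<bar>M\<bar> + 1))"
        using \<open>e > 0\<close> d0(1) by (intro mult_mono) (auto simp: d_def)
      then show "\<bar>M\<bar> * d \<le> e" by simp
    qed
    obtain U where U: "open U" "N \<subseteq> U" "U - N \<in> lmeasurable"
      "emeasure lebesgue (U - N) < ennreal d"
      using sets_lebesgue_outer_open[of N d] N(1) d(1) negligible_imp_sets by metis
    have NU: "U \<in> lmeasurable" "measure lebesgue U < d"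
    proof -
      have "U = (U - N) \<union> N" using U by auto
      then show "U \<in> lmeasurable"
        using U(3) N(1) by (metis fmeasurable.Un negligible_imp_measurable)
      have "measure lebesgue (U - N) < d"
        using U(3,4) d(1) by (metis emeasure_eq_measure2 ennreal_less_iff measure_nonneg)
      then show "measure lebesgue U < d"
        using N(1) \<open>U \<in> lmeasurable\<close>
        by (metis fmeasurableD measure_Diff_null_set negligible_iff_null_sets)
    qed
    \<comment> \<open>Gauge radius: around a point of \<open>N\<close> the ball stays in
      \<open>U\<close>; at any other point of the interval it is a radius on which the derivative
      approximates with relative error \<open>e\<close>.\<close>
    have "\<exists>D>0. if t \<in> N then ball t D \<subseteq> U else t \<in> {a..b} \<longrightarrow>
       (\<exists>v. p \<bullet> v \<le> M \<and> (\<forall>s\<in>{a..b}. \<bar>s - t\<bar> < D \<longrightarrow>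
           norm (x s - x t - (s - t) *\<^sub>R v) \<le> e * \<bar>s - t\<bar>))" for t
    proof (cases "t \<in> N")
      case True
      then show ?thesis using U(1,2) by (simp add: open_contains_ball subset_eq)
    next
      case F: False
      show ?thesis
      proof (cases "t \<in> {a..b}")
        case False
        then show ?thesis using F by (intro exI[of _ 1]) auto
      next
        case True
        then obtain v where v: "(x has_vector_derivative v) (at t within {a..b})" "p \<bullet> v \<le> M"
          using N(2) F by blast
        then obtain D where "D > 0" "\<forall>s\<in>{a..b}. norm (s - t) < D \<longrightarrow>
           norm (x s - x t - (s - t) *\<^sub>R v) \<le> e * norm (s - t)"
          using \<open>e > 0\<close> unfolding has_vector_derivative_def has_derivative_within_alt by blast
        then show ?thesis using F v by auto
      qed
    qed
    then obtain D where D: "\<And>t. D t > 0" "\<And>t. t \<in> N \<Longrightarrow> ball t (D t) \<subseteq> U"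
      "\<And>t. t \<notin> N \<Longrightarrow> t \<in> {a..b} \<Longrightarrow>
       (\<exists>v. p \<bullet> v \<le> M \<and> (\<forall>s\<in>{a..b}. \<bar>s - t\<bar> < D t \<longrightarrow>
           norm (x s - x t - (s - t) *\<^sub>R v) \<le> e * \<bar>s - t\<bar>))"
      by metis
    have "gauge (\<lambda>t. ball t (D t))" using D(1) by (simp add: gauge_def)
    then obtain P where P: "P tagged_division_of {a..b}" "(\<lambda>t. ball t (D t)) fine P"
      using fine_division_exists_real by blast
    have finP: "finite P" using P(1) by blast
    have int: "\<exists>u v. K = {u..v} \<and> u \<le> v \<and> a \<le> u \<and> v \<le> b \<and> u \<le> t \<and> t \<le> v \<and> Inf K = u \<and> Sup K = v
        \<and> K \<subseteq> ball t (D t)" if "(t, K) \<in> P" for t K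
    proof -
      obtain u v where K: "K = {u..v}" using P(1) \<open>(t,K) \<in> P\<close> by (metis box_real(2) tagged_division_ofD(4))
      moreover have "t \<in> K" "K \<subseteq> {a..b}" using P(1) that by blast+
      moreover have "K \<subseteq> ball t (D t)" using P(2) that unfolding fine_def by blast
      ultimately show ?thesis by auto
    qed
    let ?inc = "\<lambda>z::real \<times> real set. p \<bullet> (x (Sup (snd z)) - x (Inf (snd z)))"
    let ?len = "\<lambda>z::real \<times> real set. Sup (snd z) - Inf (snd z)"
    define PN where "PN = {z \<in> P. fst z \<in> N}"
    define PG where "PG = {z \<in> P. fst z \<notin> N}"
    have fin: "finite PN" using finP by (simp add: PN_def)
    have split: "sum f P = sum f PG + sum f PN" for f :: "real \<times> real set \<Rightarrow> real"
    proof -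
      have "P = PG \<union> PN" "PG \<inter> PN = {}" by (auto simp: PN_def PG_def)
      then show ?thesis using finP by (metis finite_Un sum.union_disjoint)
    qed
    have total: "sum ?inc P = p \<bullet> (x b - x a)" "sum ?len P = b - a"
      using additive_tagged_division_1[OF \<open>a \<le> b\<close> P(1), of "\<lambda>t. p \<bullet> x t"]
        additive_tagged_division_1[OF \<open>a \<le> b\<close> P(1), of "\<lambda>t. t"]
      by (simp_all add: inner_diff_right case_prod_unfold)
    have dis: "disjoint_family_on (\<lambda>z. {Inf (snd z)<..<Sup (snd z)}) PN"
      unfolding disjoint_family_on_def
    proof (intro ballI impI)
      fix y z assume yz: "y \<in> PN" "z \<in> PN" "y \<noteq> z"
      obtain t K t' K' where tK: "y = (t, K)" "z = (t', K')" by fastforce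
      have "interior K \<inter> interior K' = {}"
        by (rule tagged_division_ofD(5)[OF P(1)]) (use yz tK in \<open>simp_all add: PN_def\<close>)
      then show "{Inf (snd y)<..<Sup (snd y)} \<inter> {Inf (snd z)<..<Sup (snd z)} = {}"
        using int[of t K] int[of t' K'] yz tK unfolding PN_def
        by (metis (no_types, lifting) fst_conv interior_atLeastAtMost_real mem_Collect_eq snd_conv)
    qed
    \<comment> \<open>Division intervals may share endpoints, so the open intervals are used: they
      are disjoint, and their total length is the measure of a subset of \<open>U\<close>.\<close>
    have "sum ?len PN = (\<Sum>z\<in>PN. measure lebesgue {Inf (snd z)<..<Sup (snd z)})"
      using int by (intro sum.cong) (fastforce simp: PN_def)+
    also have "\<dots> = measure lebesgue (\<Union>z\<in>PN. {Inf (snd z)<..<Sup (snd z)})"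
      using dis by (intro measure_UNION'[symmetric] fin)
        (auto simp: disjoint_family_on_def pairwise_def disjnt_def)
    also have "\<dots> \<le> measure lebesgue U"
    proof (rule measure_mono_fmeasurable)
      show "(\<Union>z\<in>PN. {Inf (snd z)<..<Sup (snd z)}) \<subseteq> U"
      proof
        fix s assume "s \<in> (\<Union>z\<in>PN. {Inf (snd z)<..<Sup (snd z)})"
        then obtain t K where tK: "(t, K) \<in> P" "t \<in> N" "s \<in> {Inf K<..<Sup K}"
          by (auto simp: PN_def)
        then have "s \<in> ball t (D t)"
          using int[OF tK(1)] by (metis atLeastAtMost_iff greaterThanLessThan_iff less_imp_le subsetD)
        then show "s \<in> U" using D(2) tK by blast
      qed
    qed (use fin NU in \<open>auto intro!: sets.finite_UN\<close>)
    finally have len: "sum ?len PN < d" using NU by simp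
    have len0: "sum ?len PN \<ge> 0"
      using int by (intro sum_nonneg) (fastforce simp: PN_def)
    have "sum ?inc PN \<le> (\<Sum>z\<in>PN. norm p * norm (x (Sup (snd z)) - x (Inf (snd z))))"
      by (intro sum_mono) (auto simp: norm_cauchy_schwarz)
    also have "\<dots> = norm p * (\<Sum>z\<in>PN. norm (x (Sup (snd z)) - x (Inf (snd z))))"
      by (simp add: sum_distrib_left)
    also have "\<dots> \<le> norm p * e"
    proof (rule mult_left_mono)
      have "(\<Sum>z\<in>PN. norm (x (Sup (snd z)) - x (Inf (snd z)))) < e"
      proof (rule d0(2)[rule_format, OF fin _ dis])
        fix z assume "z \<in> PN"
        then have "Inf (snd z) \<le> Sup (snd z)" "a \<le> Inf (snd z)" "Sup (snd z) \<le> b"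
          using int[of "fst z" "snd z"] by (auto simp: PN_def)
        then show "Inf (snd z) \<le> Sup (snd z) \<and> {Inf (snd z)..Sup (snd z)} \<subseteq> {a..b}"
          by (simp add: atLeastatMost_subset_iff)
      qed (use len d in simp)
      then show "(\<Sum>z\<in>PN. norm (x (Sup (snd z)) - x (Inf (snd z)))) \<le> e" by simp
    qed simp
    finally have bad: "sum ?inc PN \<le> norm p * e" .
    have "sum ?inc PG \<le> (\<Sum>z\<in>PG. (M + norm p * e) * ?len z)"
    proof (rule sum_mono)
      fix z assume "z \<in> PG"
      then obtain t K where z: "z = (t, K)" "(t, K) \<in> P" "t \<notin> N" by (cases z) (auto simp: PG_def)
      obtain u v where uv: "K = {u..v}" "a \<le> u" "v \<le> b" "u \<le> t" "t \<le> v" "Inf K = u" "Sup K = v"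
        "K \<subseteq> ball t (D t)"
        using int[OF z(2)] by blast
      then have "t \<in> {a..b}" by auto
      then obtain w where w: "p \<bullet> w \<le> M" "\<And>s. s \<in> {a..b} \<Longrightarrow> \<bar>s - t\<bar> < D t \<Longrightarrow>
           norm (x s - x t - (s - t) *\<^sub>R w) \<le> e * \<bar>s - t\<bar>"
        using D(3)[OF z(3)] by blast
      have "u \<in> K" "v \<in> K" using uv by auto
      then have "\<bar>u - t\<bar> < D t" "\<bar>v - t\<bar> < D t"
        using uv(8) by (auto simp: subset_eq dist_real_def abs_minus_commute)
      then have "norm (x u - x t - (u - t) *\<^sub>R w) \<le> e * (t - u)"
        "norm (x v - x t - (v - t) *\<^sub>R w) \<le> e * (v - t)"
        using w(2)[of u] w(2)[of v] uv by auto
      \<comment> \<open>Straddling the tag: since \<open>u \<le> t \<le> v\<close>, the errors at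
        the two ends add up to \<open>e * (v - u)\<close>.\<close>
      moreover have "x v - x u - (v - u) *\<^sub>R w =
          (x v - x t - (v - t) *\<^sub>R w) - (x u - x t - (u - t) *\<^sub>R w)"
        by (simp add: algebra_simps)
      ultimately have "norm (x v - x u - (v - u) *\<^sub>R w) \<le> e * (v - t) + e * (t - u)"
        by (metis norm_triangle_le_diff add_mono)
      then have "norm (x v - x u - (v - u) *\<^sub>R w) \<le> e * (v - u)"
        by (simp add: algebra_simps)
      then have "p \<bullet> (x v - x u - (v - u) *\<^sub>R w) \<le> norm p * (e * (v - u))"
        by (meson mult_left_mono norm_cauchy_schwarz norm_ge_zero order_trans)
      moreover have "(v - u) * (p \<bullet> w) \<le> (v - u) * M"
        using w(1) uv by (intro mult_left_mono) auto
      ultimately have "p \<bullet> (x v - x u) \<le> (M + norm p * e) * (v - u)"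
        by (simp add: inner_diff_right algebra_simps)
      then show "?inc z \<le> (M + norm p * e) * ?len z" using z uv by simp
    qed
    also have "\<dots> = (M + norm p * e) * sum ?len PG" by (simp add: sum_distrib_left)
    also have "\<dots> = (M + norm p * e) * ((b - a) - sum ?len PN)"
      using split[of ?len] total by simp
    \<comment> \<open>\<open>M\<close> may be negative, and then leaving out the length over
      \<open>PN\<close> raises the bound by \<open>\<bar>M\<bar>\<close> times that length.\<close>
    also have "\<dots> \<le> M * (b - a) + norm p * e * (b - a) + \<bar>M\<bar> * sum ?len PN"
    proof -
      have "- (M * sum ?len PN) \<le> \<bar>M\<bar> * sum ?len PN"
        using mult_right_mono[OF abs_ge_minus_self len0, of M] by simp
      moreover have "norm p * e * sum ?len PN \<ge> 0" using len0 \<open>e > 0\<close> by simp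
      ultimately show ?thesis by (simp add: algebra_simps)
    qed
    also have "\<dots> \<le> M * (b - a) + norm p * e * (b - a) + e"
      using d(3) mult_left_mono[OF less_imp_le[OF len] abs_ge_zero[of M]] by simp
    finally have "sum ?inc PG \<le> M * (b - a) + norm p * e * (b - a) + e" .
    with bad have "p \<bullet> (x b - x a) \<le> M * (b - a) + norm p * e * (b - a) + e + norm p * e"
      using split[of ?inc] total by linarith
    then show ?thesis by (simp add: algebra_simps)
  qed
  have pos: "1 + norm p * (1 + b - a) > 0"
    using \<open>a \<le> b\<close> by (simp add: add_pos_nonneg)
  show ?thesis
  proof (rule field_le_epsilon)
    fix e :: real assume "e > 0"
    then show "p \<bullet> (x b - x a) \<le> M * (b - a) + e"
      using bound[of "e / (1 + norm p * (1 + b - a))"] pos by simp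
  qed
qed

subsection \<open>Trajectories\<close>

lemma trajectory_on_subset:
  assumes "trajectory_on F I x" "J \<subseteq> I"
  shows "trajectory_on F J x"
proof -
  have "AE t\<in>J in lebesgue. \<exists>v\<in>F (x t). (x has_vector_derivative v) (at t within J)"
    using assms(1) unfolding trajectory_on_def
    by (elim conjE eventually_mono)
      (use assms(2) has_vector_derivative_within_subset in blast)
  then show ?thesis
    using assms abs_continuous_on_subset unfolding trajectory_on_def by blast
qed

text \<open>Running time backwards negates the velocity, hence the multifunction \<open>- F\<close>;
  the exceptional set is mapped by an isometry and stays negligible.\<close>

lemma trajectory_on_reflect:
  assumes "trajectory_on F {a..b} x"
  shows "trajectory_on (\<lambda>y. uminus ` F y) {c - b..c - a} (\<lambda>t. x (c - t))"
proof -
  obtain N where N: "negligible N"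
    "\<And>t. t \<in> {a..b} - N \<Longrightarrow> \<exists>v\<in>F (x t). (x has_vector_derivative v) (at t within {a..b})"
    using assms unfolding trajectory_on_def AE_subset_lebesgue_iff by blast
  have "negligible ((\<lambda>t. c - t) ` N)"
  proof (rule negligible_locally_Lipschitz_image[OF _ N(1)])
    fix s
    show "\<exists>T B. open T \<and> s \<in> T \<and> (\<forall>t\<in>N \<inter> T. norm (c - t - (c - s)) \<le> B * norm (t - s))"
      by (intro exI[of _ UNIV] exI[of _ 1]) auto
  qed simp
  moreover have "\<exists>v\<in>uminus ` F (x (c - t)).
      ((\<lambda>t. x (c - t)) has_vector_derivative v) (at t within {c - b..c - a})"
    if t: "t \<in> {c - b..c - a} - (\<lambda>t. c - t) ` N" for t
  proof -
    have "c - t \<notin> N" using t image_iff by fastforce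
    then obtain v where v: "v \<in> F (x (c - t))" "(x has_vector_derivative v) (at (c - t) within {a..b})"
      using N(2)[of "c - t"] t by auto
    have im: "(\<lambda>t. c - t) ` {c - b..c - a} = {a..b}" by (simp add: image_diff_atLeastAtMost)
    have "((\<lambda>t. c - t) has_vector_derivative - 1) (at t within {c - b..c - a})"
      by (auto intro!: derivative_eq_intros)
    then have "((x \<circ> (\<lambda>t. c - t)) has_vector_derivative (- 1) *\<^sub>R v) (at t within {c - b..c - a})"
      using v(2) by (intro vector_diff_chain_within) (simp_all only: im)
    then show ?thesis using v(1) by (auto simp: o_def)
  qed
  ultimately show ?thesis
    using assms abs_continuous_on_reflect[of a b x c]
    unfolding trajectory_on_def AE_subset_lebesgue_iff by meson
qed

text \<open>A translation is the composition of two reflections, and the two sign changes of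
  \<open>F\<close> cancel.\<close>

lemma trajectory_on_shift:
  assumes "trajectory_on F {a..b} x"
  shows "trajectory_on F {a - c..b - c} (\<lambda>t. x (c + t))"
  using trajectory_on_reflect[OF trajectory_on_reflect[OF assms, of c], of 0]
  by (simp add: image_image)

lemma trajectory_on_cong:
  assumes "\<And>t. t \<in> I \<Longrightarrow> x t = y t" "trajectory_on F I x"
  shows "trajectory_on F I y"
proof -
  have "\<exists>v\<in>F (y t). (y has_vector_derivative v) (at t within I)"
    if "t \<in> I" "\<exists>v\<in>F (x t). (x has_vector_derivative v) (at t within I)" for t
    using that assms(1) has_vector_derivative_transform[of t I y x] by auto
  then have "AE t\<in>I in lebesgue. \<exists>v\<in>F (y t). (y has_vector_derivative v) (at t within I)"
    using assms(2) unfolding trajectory_on_def by (elim conjE eventually_mono) blast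
  then show ?thesis
    using assms(2) abs_continuous_on_cong[of I x y, OF assms(1)] unfolding trajectory_on_def by simp
qed

lemma trajectory_on_combine:
  assumes "trajectory_on F {a..c} x" "trajectory_on F {c..b} x"
  shows "trajectory_on F {a..b} x"
proof -
  obtain N1 where N1: "negligible N1"
    "\<And>t. t \<in> {a..c} - N1 \<Longrightarrow> \<exists>v\<in>F (x t). (x has_vector_derivative v) (at t within {a..c})"
    using assms(1) unfolding trajectory_on_def AE_subset_lebesgue_iff by blast
  obtain N2 where N2: "negligible N2"
    "\<And>t. t \<in> {c..b} - N2 \<Longrightarrow> \<exists>v\<in>F (x t). (x has_vector_derivative v) (at t within {c..b})"
    using assms(2) unfolding trajectory_on_def AE_subset_lebesgue_iff by blast
  \<comment> \<open>Away from these three points the derivative within a subinterval is the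
    two-sided derivative, which restricts to any larger interval.\<close>
  let ?N = "N1 \<union> N2 \<union> {a, b, c}"
  have "negligible ?N" using N1(1) N2(1) by (intro negligible_Un negligible_finite[of "{a, b, c}"]) auto
  moreover have "\<exists>v\<in>F (x t). (x has_vector_derivative v) (at t within {a..b})"
    if t: "t \<in> {a..b} - ?N" for t
  proof (cases "t < c")
    case True
    then have "t \<in> {a<..<c}" using t by auto
    then have "at t within {a..c} = at t"
      by (intro at_within_interior) simp
    then show ?thesis using N1(2)[of t] True t has_vector_derivative_at_within by fastforce
  next
    case False
    then have "t \<in> {c<..<b}" using t by auto
    then have "at t within {c..b} = at t"
      by (intro at_within_interior) simp
    then show ?thesis using N2(2)[of t] False t has_vector_derivative_at_within by fastforce
  qed
  ultimately show ?thesis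
    using assms abs_continuous_on_combine[of a c x b]
    unfolding trajectory_on_def AE_subset_lebesgue_iff by meson
qed

section \<open>Arcs of a given duration and the minimal time\<close>

text \<open>Arcs of an exact duration can be cut and concatenated, which the infimum
  \<open>bilateral_min_time\<close> does not allow directly; the infimum is approached through
  almost optimal durations.\<close>

definition reaches :: "(real^'n \<Rightarrow> (real^'n) set) \<Rightarrow> real \<Rightarrow> real^'n \<Rightarrow> real^'n \<Rightarrow> bool" where
  "reaches F t a b \<longleftrightarrow> t \<ge> 0 \<and> (\<exists>x. trajectory_on F {0..t} x \<and> x 0 = a \<and> x t = b)"

lemma reaches_reflect:
  assumes "reaches F t a b"
  shows "reaches (\<lambda>x. uminus ` F x) t b a"
proof -
  obtain x where "t \<ge> 0" "trajectory_on F {0..t} x" "x 0 = a" "x t = b"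
    using assms unfolding reaches_def by blast
  then show ?thesis
    using trajectory_on_reflect[of F 0 t x t] unfolding reaches_def
    by (intro conjI exI[of _ "\<lambda>s. x (t - s)"]) auto
qed

lemma reaches_reflect_iff: "reaches (\<lambda>x. uminus ` F x) t b a \<longleftrightarrow> reaches F t a b"
  using reaches_reflect[of F t a b] reaches_reflect[of "\<lambda>x. uminus ` F x" t b a]
  by (auto simp: image_image)

lemma reaches_split:
  assumes "reaches F t a b" "0 \<le> s" "s \<le> t"
  obtains m where "reaches F s a m" "reaches F (t - s) m b"
proof -
  obtain x where x: "t \<ge> 0" "trajectory_on F {0..t} x" "x 0 = a" "x t = b"
    using assms unfolding reaches_def by blast
  have "trajectory_on F {0..s} x"
    by (rule trajectory_on_subset[OF x(2)]) (use assms in auto)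
  then have "reaches F s a (x s)" using x assms unfolding reaches_def by blast
  moreover have "trajectory_on F {s..t} x"
    by (rule trajectory_on_subset[OF x(2)]) (use assms in auto)
  then have "trajectory_on F {0..t - s} (\<lambda>u. x (s + u))"
    using trajectory_on_shift[of F s t x s] by simp
  then have "reaches F (t - s) (x s) b"
    using x assms unfolding reaches_def by (intro conjI exI[of _ "\<lambda>u. x (s + u)"]) auto
  ultimately show thesis by (rule that)
qed

lemma reaches_trans:
  assumes "reaches F s a m" "reaches F t m b"
  shows "reaches F (s + t) a b"
proof -
  obtain x where x: "s \<ge> 0" "trajectory_on F {0..s} x" "x 0 = a" "x s = m"
    using assms(1) unfolding reaches_def by blast
  obtain y where y: "t \<ge> 0" "trajectory_on F {0..t} y" "y 0 = m" "y t = b"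
    using assms(2) unfolding reaches_def by blast
  define z where "z = (\<lambda>u. if u \<le> s then x u else y (u - s))"
  have "trajectory_on F {0..s} z"
    by (rule trajectory_on_cong[OF _ x(2)]) (simp add: z_def)
  moreover have "trajectory_on F {s..s + t} z"
  proof (rule trajectory_on_cong)
    show "trajectory_on F {s..s + t} (\<lambda>u. y (u - s))"
      using trajectory_on_shift[OF y(2), of "- s"] by (simp add: add.commute)
  qed (auto simp: z_def x y)
  ultimately have "trajectory_on F {0..s + t} z" by (rule trajectory_on_combine)
  moreover have "z 0 = a" "z (s + t) = b" using x y by (auto simp: z_def)
  ultimately show ?thesis using x y unfolding reaches_def by (intro conjI exI[of _ z]) auto
qed

lemma bilateral_min_time_eq: "bilateral_min_time F (a, b) = Inf {ereal t | t. reaches F t a b}"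
  unfolding bilateral_min_time_def reaches_def by simp

lemma bilateral_min_time_le_reaches:
  assumes "reaches F t a b"
  shows "bilateral_min_time F (a, b) \<le> ereal t"
  unfolding bilateral_min_time_eq using assms by (blast intro: Inf_lower)

lemma reaches_of_bilateral_min_time_less:
  assumes "bilateral_min_time F (a, b) < ereal s"
  obtains t where "t < s" "reaches F t a b"
  using assms unfolding bilateral_min_time_eq Inf_less_iff by auto

lemma bilateral_min_time_reflect:
  "bilateral_min_time (\<lambda>x. uminus ` F x) (b, a) = bilateral_min_time F (a, b)"
  unfolding bilateral_min_time_eq reaches_reflect_iff ..

text \<open>The time from \<open>m\<close> is approached by durations below \<open>r + e\<close>;
  prefixing the first arc adds \<open>s\<close>, and \<open>e\<close> is arbitrary.\<close>

lemma bilateral_min_time_triangle: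
  assumes "reaches F s a m" "bilateral_min_time F (m, b) \<le> ereal r"
  shows "bilateral_min_time F (a, b) \<le> ereal (r + s)"
proof (rule ereal_le_epsilon2)
  fix e :: real assume "e > 0"
  then have "bilateral_min_time F (m, b) < ereal (r + e)"
    using assms(2) by (intro le_less_trans[OF assms(2)]) simp
  then obtain t where "t < r + e" "reaches F t m b"
    by (rule reaches_of_bilateral_min_time_less)
  then have "bilateral_min_time F (a, b) \<le> ereal (s + t)"
    using bilateral_min_time_le_reaches reaches_trans[OF assms(1)] by blast
  also have "\<dots> \<le> ereal (r + s) + ereal e" using \<open>t < r + e\<close> by simp
  finally show "bilateral_min_time F (a, b) \<le> ereal (r + s) + ereal e" .
qed

subsection \<open>Peano's theorem\<close>

text \<open>For a negative upper limit \<open>{0..t}\<close> is empty and the integral is 0, so the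
  bound holds on the whole line. This gives delayed solutions a constant past.\<close>

lemma integral_lipschitz_upper_limit:
  fixes g :: "real \<Rightarrow> 'a::banach"
  assumes "continuous_on UNIV g" "\<And>s. norm (g s) \<le> M"
  shows "norm (integral {0..s} g - integral {0..t} g) \<le> M * \<bar>s - t\<bar>"
proof -
  have "M \<ge> 0" using assms(2)[of 0] norm_ge_zero order_trans by blast
  have cont: "continuous_on S g" for S using assms(1) continuous_on_subset by blast
  have *: "norm (integral {0..t} g - integral {0..s} g) \<le> M * (t - s)" if "s \<le> t" for s t
  proof (cases "s \<le> 0")
    case True
    have s0: "integral {0..s} g = 0"
      using True by (cases "s = 0") auto
    show ?thesis
    proof (cases "t \<le> 0")
      case True
      then have "integral {0..t} g = 0" by (cases "t = 0") auto
      with s0 show ?thesis using that \<open>M \<ge> 0\<close> by simp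
    next
      case False
      then have "norm (integral {0..t} g) \<le> M * (t - 0)"
        by (intro integral_bound cont assms(2)) auto
      also have "\<dots> \<le> M * (t - s)" using True \<open>M \<ge> 0\<close> by (intro mult_left_mono) auto
      finally show ?thesis using s0 by simp
    qed
  next
    case False
    then have "integral {0..s} g + integral {s..t} g = integral {0..t} g"
      using that by (intro Henstock_Kurzweil_Integration.integral_combine integrable_continuous_interval cont) auto
    then have "integral {0..t} g - integral {0..s} g = integral {s..t} g"
      by (simp add: algebra_simps)
    then show ?thesis using that by (auto intro!: integral_bound cont assms(2))
  qed
  show ?thesis
    using *[of s t] *[of t s] by (cases "s \<le> t") (auto simp: norm_minus_commute)
qed

text \<open>Method of steps: up to time \<open>(k + 1) * h\<close> the right-hand side sees the
  solution only up to \<open>k * h\<close>. Each Picard iteration therefore fixes one more interval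
  of length \<open>h\<close>, and finitely many iterations settle everything up to
  \<open>T\<close>.\<close>

lemma delayed_equation_solution:
  fixes f :: "'a::banach \<Rightarrow> 'a"
  assumes f: "continuous_on UNIV f" "\<And>y. norm (f y) \<le> M" and "h > 0"
  obtains x where "\<And>t. t \<le> T \<Longrightarrow> x t = \<alpha> + integral {0..t} (\<lambda>s. f (x (s - h)))"
    "\<And>s t. norm (x s - x t) \<le> M * \<bar>s - t\<bar>"
proof -
  have "M \<ge> 0" using f(2)[of 0] norm_ge_zero order_trans by blast
  define X where "X = rec_nat (\<lambda>t. \<alpha>) (\<lambda>k x t. \<alpha> + integral {0..t} (\<lambda>s. f (x (s - h))))"
  have X0: "X 0 = (\<lambda>t. \<alpha>)"
    and XS: "X (Suc k) t = \<alpha> + integral {0..t} (\<lambda>s. f (X k (s - h)))" for k t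
    by (simp_all add: X_def)
  have lip: "norm (X k s - X k t) \<le> M * \<bar>s - t\<bar>" for k s t
  proof (induction k arbitrary: s t)
    case 0
    then show ?case using \<open>M \<ge> 0\<close> by (simp add: X0)
  next
    case (Suc k)
    have "M-lipschitz_on UNIV (X k)"
      using Suc \<open>M \<ge> 0\<close> by (auto intro!: lipschitz_onI simp: dist_norm)
    then have "continuous_on UNIV (X k)" by (rule lipschitz_on_continuous_on)
    then have "continuous_on UNIV (\<lambda>s. X k (s - h))"
      by (rule continuous_on_compose2) (auto intro!: continuous_intros)
    then have "continuous_on UNIV (\<lambda>s. f (X k (s - h)))"
      by (rule continuous_on_compose2[OF f(1)]) auto
    from integral_lipschitz_upper_limit[OF this f(2)] show ?case by (simp add: XS)
  qed
  have stable: "X (Suc k) t = X k t" if "t \<le> real k * h" for k t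
    using that
  proof (induction k arbitrary: t)
    case 0
    then have "integral {0..t} (\<lambda>s. f (X 0 (s - h))) = 0" by (cases "t = 0") auto
    then show ?case by (simp add: XS X0)
  next
    case (Suc k)
    have "integral {0..t} (\<lambda>s. f (X (Suc k) (s - h))) = integral {0..t} (\<lambda>s. f (X k (s - h)))"
    proof (rule Henstock_Kurzweil_Integration.integral_cong)
      fix s assume "s \<in> {0..t}"
      then have "s - h \<le> real k * h" using Suc.prems by (auto simp: algebra_simps)
      then show "f (X (Suc k) (s - h)) = f (X k (s - h))" using Suc.IH by simp
    qed
    then show ?case by (simp only: XS)
  qed
  obtain N where "T / h \<le> real N" using real_arch_simple by blast
  then have N: "T \<le> real N * h" using \<open>h > 0\<close> by (simp add: divide_simps)
  show thesis
  proof (rule that[of "X N"])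
    fix t assume "t \<le> T"
    then have "X N t = X (Suc N) t" using stable[of t N] N by simp
    then show "X N t = \<alpha> + integral {0..t} (\<lambda>s. f (X N (s - h)))" by (simp add: XS)
  qed (rule lip)
qed

text \<open>Tonelli's scheme: the solutions with delay \<open>1 / (n + 1)\<close> are bounded on
  \<open>{0..T}\<close> and share a Lipschitz constant, so a subsequence converges uniformly by
  Arzela-Ascoli, and dominated convergence passes to the limit in the integral equation.\<close>

lemma peano_existence:
  fixes f :: "'a::euclidean_space \<Rightarrow> 'a"
  assumes f: "continuous_on UNIV f" "\<And>y. norm (f y) \<le> M" and "T \<ge> 0"
  obtains x where "x 0 = \<alpha>"
    "\<And>t. t \<in> {0..T} \<Longrightarrow> (x has_vector_derivative f (x t)) (at t within {0..T})"
    "\<And>s t. s \<in> {0..T} \<Longrightarrow> t \<in> {0..T} \<Longrightarrow> norm (x s - x t) \<le> M * \<bar>s - t\<bar>"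
proof -
  have "M \<ge> 0" using f(2)[of 0] norm_ge_zero order_trans by blast
  define h where "h n = 1 / real (Suc n)" for n
  have h: "h n > 0" for n by (simp add: h_def)
  have h0: "h \<longlonglongrightarrow> 0" unfolding h_def using LIMSEQ_inverse_real_of_nat by (simp add: inverse_eq_divide)
  have "\<exists>x. (\<forall>t\<le>T. x t = \<alpha> + integral {0..t} (\<lambda>s. f (x (s - h n)))) \<and>
      (\<forall>s t. norm (x s - x t) \<le> M * \<bar>s - t\<bar>)" for n
    using delayed_equation_solution[OF f h[of n], of T \<alpha>] by metis
  then obtain X where X: "\<And>n t. t \<le> T \<Longrightarrow> X n t = \<alpha> + integral {0..t} (\<lambda>s. f (X n (s - h n)))"
    and lip: "\<And>n s t. norm (X n s - X n t) \<le> M * \<bar>s - t\<bar>"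
    by metis
  have bd: "norm (X n t) \<le> norm \<alpha> + M * T" if "t \<in> {0..T}" for n t
  proof -
    have "X n 0 = \<alpha>" using X[of 0 n] \<open>T \<ge> 0\<close> by simp
    then have "norm (X n t - \<alpha>) \<le> M * T"
      using lip[of n t 0] that mult_left_mono[of t T M] \<open>M \<ge> 0\<close> by simp
    then show ?thesis using norm_triangle_sub[of "X n t" \<alpha>] by simp
  qed
  have eq: "\<exists>d. 0 < d \<and> (\<forall>n s. s \<in> {0..T} \<and> norm (t - s) < d \<longrightarrow> norm (X n t - X n s) < e)"
    if "t \<in> {0..T}" "e > 0" for t e
  proof (intro exI conjI allI impI)
    show "e / (M + 1) > 0" using \<open>e > 0\<close> \<open>M \<ge> 0\<close> by simp
    fix n s assume "s \<in> {0..T} \<and> norm (t - s) < e / (M + 1)"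
    then have "(M + 1) * \<bar>t - s\<bar> < e" using \<open>M \<ge> 0\<close> by (simp add: field_simps)
    moreover have "M * \<bar>t - s\<bar> \<le> (M + 1) * \<bar>t - s\<bar>" by (intro mult_right_mono) auto
    ultimately show "norm (X n t - X n s) < e" using lip[of n t s] by linarith
  qed
  obtain g k where g: "continuous_on {0..T} g" "strict_mono (k :: nat \<Rightarrow> nat)"
    "\<And>e. 0 < e \<Longrightarrow> \<exists>N. \<forall>n t. n \<ge> N \<and> t \<in> {0..T} \<longrightarrow> norm (X (k n) t - g t) < e"
    by (rule Arzela_Ascoli[of "{0..T}" X, OF compact_Icc bd eq]) auto
  have lim: "(\<lambda>n. X (k n) t) \<longlonglongrightarrow> g t" if "t \<in> {0..T}" for t
    unfolding LIMSEQ_iff using g(3) that by metis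
  have hk: "(\<lambda>n. h (k n)) \<longlonglongrightarrow> 0"
    using LIMSEQ_subseq_LIMSEQ[OF h0 g(2)] by (simp add: o_def)
  \<comment> \<open>The delay moves the argument by \<open>h (k n)\<close>, hence the value by at
    most \<open>M * h (k n)\<close>. The Lipschitz bound holds on the whole line, so negative
    arguments are harmless.\<close>
  have lim': "(\<lambda>n. X (k n) (t - h (k n))) \<longlonglongrightarrow> g t" if "t \<in> {0..T}" for t
  proof (rule Lim_transform2[OF lim[OF that]])
    show "(\<lambda>n. X (k n) t - X (k n) (t - h (k n))) \<longlonglongrightarrow> 0"
    proof (rule Lim_null_comparison)
      show "\<forall>\<^sub>F n in sequentially. norm (X (k n) t - X (k n) (t - h (k n))) \<le> M * h (k n)"
      proof (rule always_eventually, rule allI)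
        show "norm (X (k n) t - X (k n) (t - h (k n))) \<le> M * h (k n)" for n
          using lip[of "k n" t "t - h (k n)"] h[of "k n"] by simp
      qed
      show "(\<lambda>n. M * h (k n)) \<longlonglongrightarrow> 0" by (rule tendsto_mult_right_zero[OF hk])
    qed
  qed
  have Xcont: "continuous_on UNIV (\<lambda>s. f (X n (s - h n)))" for n
  proof -
    have "M-lipschitz_on UNIV (X n)"
      using lip \<open>M \<ge> 0\<close> by (auto intro!: lipschitz_onI simp: dist_norm)
    then have "continuous_on UNIV (X n)" by (rule lipschitz_on_continuous_on)
    then have "continuous_on UNIV (\<lambda>s. X n (s - h n))"
      by (rule continuous_on_compose2) (auto intro!: continuous_intros)
    then show ?thesis by (rule continuous_on_compose2[OF f(1)]) auto
  qed
  have fcont: "isCont f y" for y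
    using f(1) by (simp add: continuous_on_eq_continuous_at)
  have int: "g t = \<alpha> + integral {0..t} (\<lambda>s. f (g s))" if t: "t \<in> {0..T}" for t
  proof -
    have "(\<lambda>n. integral {0..t} (\<lambda>s. f (X (k n) (s - h (k n))))) \<longlonglongrightarrow> integral {0..t} (\<lambda>s. f (g s))"
    proof (rule dominated_convergence(2)[where h = "\<lambda>_. M"])
      show "(\<lambda>s. f (X (k n) (s - h (k n)))) integrable_on {0..t}" for n
        using Xcont continuous_on_subset by (intro integrable_continuous_interval) blast
      show "(\<lambda>n. f (X (k n) (s - h (k n)))) \<longlonglongrightarrow> f (g s)" if "s \<in> {0..t}" for s
        using t that by (intro isCont_tendsto_compose[OF fcont] lim') auto
    qed (use f(2) in auto)
    then have "(\<lambda>n. X (k n) t) \<longlonglongrightarrow> \<alpha> + integral {0..t} (\<lambda>s. f (g s))"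
      using t by (subst X) (auto intro!: tendsto_intros)
    then show ?thesis using lim[OF t] LIMSEQ_unique by blast
  qed
  show thesis
  proof (rule that[of g])
    show "g 0 = \<alpha>" using int[of 0] \<open>T \<ge> 0\<close> by simp
    fix t assume t: "t \<in> {0..T}"
    have "continuous_on {0..T} (\<lambda>s. f (g s))"
      using continuous_on_compose2[OF f(1) g(1)] by auto
    then have "((\<lambda>u. integral {0..u} (\<lambda>s. f (g s))) has_vector_derivative f (g t)) (at t within {0..T})"
      using t by (rule integral_has_vector_derivative)
    then have "((\<lambda>u. \<alpha> + integral {0..u} (\<lambda>s. f (g s))) has_vector_derivative f (g t)) (at t within {0..T})"
      by (auto intro!: derivative_eq_intros)
    then show "(g has_vector_derivative f (g t)) (at t within {0..T})"
      by (rule has_vector_derivative_transform[OF t int, rotated])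
    fix s assume "s \<in> {0..T}"
    then have "(\<lambda>n. norm (X (k n) s - X (k n) t)) \<longlonglongrightarrow> norm (g s - g t)"
      using t lim by (intro tendsto_intros) auto
    then show "norm (g s - g t) \<le> M * \<bar>s - t\<bar>"
      using lip by (intro LIMSEQ_le_const2) auto
  qed
qed

subsection \<open>Local estimates for trajectories\<close>

text \<open>Form used below: the vector of the unit ball is absorbed into a distance estimate
  between velocities. Passing to \<open>\<bar>L\<bar>\<close> secures a sign that \<open>F2\<close>
  leaves open.\<close>

lemma F2_local:
  assumes "F2 F"
  obtains L where "L \<ge> 0" "\<And>x y v. x \<in> cball \<alpha> R \<Longrightarrow> y \<in> cball \<alpha> R \<Longrightarrow> v \<in> F x \<Longrightarrow>
    \<exists>w\<in>F y. norm (v - w) \<le> L * norm (y - x)"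
proof -
  obtain L where L: "\<And>x y. x \<in> cball \<alpha> R \<Longrightarrow> y \<in> cball \<alpha> R \<Longrightarrow>
      F x \<subseteq> {v + (L * norm (y - x)) *\<^sub>R b | v b. v \<in> F y \<and> b \<in> cball 0 1}"
    using assms unfolding F2_def by (meson compact_cball)
  show thesis
  proof (rule that[of "\<bar>L\<bar>"])
    fix x y v assume "x \<in> cball \<alpha> R" "y \<in> cball \<alpha> R" "v \<in> F x"
    then obtain w b where w: "w \<in> F y" "norm b \<le> 1" "v = w + (L * norm (y - x)) *\<^sub>R b"
      using L[of x y] by auto
    then have "norm (v - w) = \<bar>L\<bar> * norm (y - x) * norm b" by (simp add: abs_mult)
    also have "\<dots> \<le> \<bar>L\<bar> * norm (y - x)" using w(2) by (intro mult_left_le) auto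
    finally show "\<exists>w\<in>F y. norm (v - w) \<le> \<bar>L\<bar> * norm (y - x)" using w(1) by blast
  qed simp
qed

lemma F3_local:
  assumes "F3 F" "R \<ge> 0"
  obtains M where "M > 0" "\<And>x v. norm (x - \<alpha>) \<le> R \<Longrightarrow> v \<in> F x \<Longrightarrow> norm v \<le> M"
proof -
  obtain g c where gc: "g > 0" "c > 0" "\<And>x v. v \<in> F x \<Longrightarrow> norm v \<le> g * norm x + c"
    using assms unfolding F3_def by blast
  show thesis
  proof (rule that[of "g * (norm \<alpha> + R) + c"])
    show "g * (norm \<alpha> + R) + c > 0" using gc assms(2) by (simp add: add_nonneg_pos)
    fix x v assume "norm (x - \<alpha>) \<le> R" "v \<in> F x"
    have "norm x \<le> norm \<alpha> + R"
      using norm_triangle_sub[of x \<alpha>] \<open>norm (x - \<alpha>) \<le> R\<close> by simp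
    then have "g * norm x \<le> g * (norm \<alpha> + R)" using gc(1) by simp
    then show "norm v \<le> g * (norm \<alpha> + R) + c" using gc(3)[OF \<open>v \<in> F x\<close>] by simp
  qed
qed

text \<open>The final time can join the null set, so the velocity bound is asked only before it. The
  first-exit argument in \<open>reaches_estimate\<close> supplies the bound only there.\<close>

lemma trajectory_inner_increment_le:
  assumes "s \<ge> 0" "trajectory_on F {0..s} y"
    and le: "\<And>u v. 0 \<le> u \<Longrightarrow> u < s \<Longrightarrow> v \<in> F (y u) \<Longrightarrow> p \<bullet> v \<le> B"
  shows "p \<bullet> (y s - y 0) \<le> B * s"
proof -
  obtain N where N: "negligible N"
    "\<And>t. t \<in> {0..s} - N \<Longrightarrow> \<exists>v\<in>F (y t). (y has_vector_derivative v) (at t within {0..s})"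
    using assms(2) unfolding trajectory_on_def AE_subset_lebesgue_iff by blast
  have "negligible (insert s N)" using N(1) by simp
  moreover have "\<exists>v. (y has_vector_derivative v) (at t within {0..s}) \<and> p \<bullet> v \<le> B"
    if t: "t \<in> {0..s} - insert s N" for t
    using N(2)[of t] t le[of t] by fastforce
  ultimately have "AE t\<in>{0..s} in lebesgue.
      \<exists>v. (y has_vector_derivative v) (at t within {0..s}) \<and> p \<bullet> v \<le> B"
    unfolding AE_subset_lebesgue_iff by meson
  moreover have "abs_continuous_on {0..s} y" using assms(2) by (simp add: trajectory_on_def)
  ultimately show ?thesis
    using abs_continuous_inner_increment_le[OF assms(1), of y p B] by simp
qed

text \<open>Test the inner product estimate with the increment itself and cancel one factor of its
  norm.\<close>

lemma trajectory_norm_increment_le: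
  assumes "s \<ge> 0" "trajectory_on F {0..s} y" "B \<ge> 0"
    and le: "\<And>u v. 0 \<le> u \<Longrightarrow> u < s \<Longrightarrow> v \<in> F (y u) \<Longrightarrow> norm v \<le> B"
  shows "norm (y s - y 0) \<le> B * s"
proof (cases "y s = y 0")
  case True
  then show ?thesis using assms(1) \<open>B \<ge> 0\<close> by simp
next
  case False
  let ?p = "y s - y 0"
  have "?p \<bullet> (y s - y 0) \<le> (norm ?p * B) * s"
  proof (rule trajectory_inner_increment_le[OF assms(1,2)])
    fix u v assume "0 \<le> u" "u < s" "v \<in> F (y u)"
    then have "norm ?p * norm v \<le> norm ?p * B" using le by (intro mult_left_mono) auto
    then show "?p \<bullet> v \<le> norm ?p * B" using norm_cauchy_schwarz[of ?p v] by simp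
  qed
  then have "norm ?p * norm ?p \<le> norm ?p * (B * s)"
    by (simp add: dot_square_norm power2_eq_square mult.assoc)
  then show ?thesis using False by simp
qed

lemma hamiltonian_le:
  assumes "F1 F" "w \<in> F x"
  shows "hamiltonian F x p \<le> w \<bullet> p"
  using hamiltonian_is_min[OF assms(1), of x p] assms(2) by auto

text \<open>By the Lipschitz condition every velocity met along the arc is close to some velocity in
  \<open>F \<alpha>\<close>, whose product with \<zeta> is at least
  \<open>hamiltonian F \<alpha> \<zeta>\<close>. The error is proportional to the distance from
  \<alpha>, at most \<open>norm (x - \<alpha>) + M * t\<close>; integration yields the second
  bound.\<close>

lemma reaches_estimate:
  assumes "F1 F" "F2 F" "F3 F"
  obtains C d where "C > 0" "d > 0"
    "\<And>x t m. norm (x - \<alpha>) \<le> 1 \<Longrightarrow> t \<le> d \<Longrightarrow> reaches F t x m \<Longrightarrow> norm (m - x) \<le> C * t"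
    "\<And>x t m. norm (x - \<alpha>) \<le> 1 \<Longrightarrow> t \<le> d \<Longrightarrow> reaches F t x m \<Longrightarrow>
      t * (hamiltonian F \<alpha> \<zeta> - C * (norm (x - \<alpha>) + t)) \<le> \<zeta> \<bullet> (m - x)"
proof -
  obtain M where M: "M > 0" "\<And>x v. norm (x - \<alpha>) \<le> 2 \<Longrightarrow> v \<in> F x \<Longrightarrow> norm v \<le> M"
    using F3_local[OF assms(3), of 2 \<alpha>] by auto
  obtain L where L: "L \<ge> 0" "\<And>x y v. x \<in> cball \<alpha> 2 \<Longrightarrow> y \<in> cball \<alpha> 2 \<Longrightarrow> v \<in> F x \<Longrightarrow>
    \<exists>w\<in>F y. norm (v - w) \<le> L * norm (y - x)"
    using F2_local[OF assms(2), of \<alpha> 2] by blast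
  \<comment> \<open>One constant dominating \<open>M\<close>, \<open>norm \<zeta> * L\<close> and
    \<open>norm \<zeta> * L * M\<close>, the coefficients of the sharper estimate
    \<open>main\<close>.\<close>
  define C where "C = M + norm \<zeta> * L * (1 + M)"
  have L\<zeta>: "norm \<zeta> * L \<ge> 0" using L(1) by simp
  then have L\<zeta>M: "norm \<zeta> * L * M \<ge> 0" using M(1) by simp
  have C: "C \<ge> M" "C \<ge> norm \<zeta> * L" "C \<ge> norm \<zeta> * L * M"
    using M(1) L\<zeta> L\<zeta>M by (auto simp: C_def algebra_simps)
  have main: "norm (m - x) \<le> M * t \<and>
      t * (hamiltonian F \<alpha> \<zeta> - norm \<zeta> * L * (norm (x - \<alpha>) + M * t)) \<le> \<zeta> \<bullet> (m - x)"
    if x: "norm (x - \<alpha>) \<le> 1" and t: "t \<le> 1 / (2 * M)" and r: "reaches F t x m" for x t m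
  proof -
    obtain y where y: "t \<ge> 0" "trajectory_on F {0..t} y" "y 0 = x" "y t = m"
      using r unfolding reaches_def by blast
    have near: "norm (y u - \<alpha>) \<le> 2" if "norm (y u - y 0) < 1" for u
      using norm_triangle_ineq[of "y u - y 0" "y 0 - \<alpha>"] x y(3) that by simp
    have Mt: "M * t < 1" using t M(1) by (simp add: field_simps)
    have sub: "trajectory_on F {0..s} y" if "s \<le> t" for s
      by (rule trajectory_on_subset[OF y(2)]) (use that in auto)
    \<comment> \<open>Times at which the arc is at distance at least 1 from its start. Before the
      first such time \<open>s\<close> the speed is at most \<open>M\<close>, so
      \<open>1 \<le> M * s \<le> M * t < 1\<close>, a contradiction.\<close>
    define S where "S = {s \<in> {0..t}. 1 \<le> norm (y s - y 0)}"
    have "S = {}"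
    proof (rule ccontr)
      assume "S \<noteq> {}"
      have "continuous_on {0..t} y"
        using y(2) abs_continuous_on_imp_continuous_on by (auto simp: trajectory_on_def)
      then have "closed S" unfolding S_def
        by (intro continuous_closed_preimage_constant continuous_on_closed_Collect_le
            closed_atLeastAtMost continuous_intros)
      moreover have "bounded S"
        by (rule bounded_subset[of "{0..t}"]) (auto simp: S_def)
      ultimately have "compact S" by (simp add: compact_eq_bounded_closed)
      then obtain s where s: "s \<in> S" "\<And>u. u \<in> S \<Longrightarrow> s \<le> u"
        using \<open>S \<noteq> {}\<close> compact_attains_inf by metis
      have st: "0 \<le> s" "s \<le> t" using s(1) by (auto simp: S_def)
      have "norm (y s - y 0) \<le> M * s"
      proof (rule trajectory_norm_increment_le[OF st(1) sub[OF st(2)] less_imp_le[OF M(1)]])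
        fix u v assume u: "0 \<le> u" "u < s" "v \<in> F (y u)"
        then have "u \<notin> S" using s(2) by force
        then have "norm (y u - y 0) < 1" using u st by (auto simp: S_def)
        then show "norm v \<le> M" using near M(2) u(3) by blast
      qed
      moreover have "M * s \<le> M * t" using st M(1) by simp
      ultimately show False using s(1) Mt by (simp add: S_def)
    qed
    then have stay: "norm (y u - \<alpha>) \<le> 2" if "u \<in> {0..t}" for u
      using near[of u] that by (force simp: S_def)
    have inc: "norm (y u - y 0) \<le> M * u" if "u \<in> {0..t}" for u
    proof (rule trajectory_norm_increment_le[of u F])
      fix w v assume "0 \<le> w" "w < u" "v \<in> F (y w)"
      then show "norm v \<le> M" using that M(2)[OF stay[of w]] by auto
    qed (use that M(1) sub in auto)
    \<comment> \<open>The increment lemma bounds from above, so the lower bound is obtained by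
      testing with \<open>- \<zeta>\<close>.\<close>
    have "(- \<zeta>) \<bullet> (y t - y 0) \<le>
        (- hamiltonian F \<alpha> \<zeta> + norm \<zeta> * L * (norm (x - \<alpha>) + M * t)) * t"
    proof (rule trajectory_inner_increment_le[OF y(1,2)])
      fix u v assume u: "0 \<le> u" "u < t" "v \<in> F (y u)"
      have "y u \<in> cball \<alpha> 2" "\<alpha> \<in> cball \<alpha> 2"
        using stay[of u] u by (auto simp: dist_norm norm_minus_commute)
      then obtain w where w: "w \<in> F \<alpha>" "norm (v - w) \<le> L * norm (\<alpha> - y u)"
        using L(2) u(3) by blast
      have "norm (\<alpha> - y u) \<le> norm (y u - y 0) + norm (y 0 - \<alpha>)"
        using norm_triangle_ineq[of "y u - y 0" "y 0 - \<alpha>"] by (simp add: norm_minus_commute)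
      also have "\<dots> \<le> norm (x - \<alpha>) + M * t"
      proof -
        have "M * u \<le> M * t" using u M(1) by (intro mult_left_mono) auto
        then show ?thesis using inc[of u] u y(3) by auto
      qed
      finally have "L * norm (\<alpha> - y u) \<le> L * (norm (x - \<alpha>) + M * t)"
        using L(1) by (rule mult_left_mono)
      then have "norm (v - w) \<le> L * (norm (x - \<alpha>) + M * t)" using w(2) by simp
      then have "norm \<zeta> * norm (v - w) \<le> norm \<zeta> * (L * (norm (x - \<alpha>) + M * t))"
        by (rule mult_left_mono) simp
      moreover have "\<zeta> \<bullet> w - \<zeta> \<bullet> v \<le> norm \<zeta> * norm (v - w)"
        using norm_cauchy_schwarz[of \<zeta> "w - v"] by (simp add: inner_diff_right norm_minus_commute)
      moreover have "hamiltonian F \<alpha> \<zeta> \<le> \<zeta> \<bullet> w"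
        using hamiltonian_le[OF assms(1) w(1)] by (simp add: inner_commute)
      ultimately show "(- \<zeta>) \<bullet> v \<le> - hamiltonian F \<alpha> \<zeta> + norm \<zeta> * L * (norm (x - \<alpha>) + M * t)"
        by (simp add: mult.assoc)
    qed
    then have "t * (hamiltonian F \<alpha> \<zeta> - norm \<zeta> * L * (norm (x - \<alpha>) + M * t)) \<le> \<zeta> \<bullet> (m - x)"
      using y by (simp add: inner_diff_right algebra_simps)
    then show ?thesis using inc[of t] y by auto
  qed
  show thesis
  proof (rule that[of C "1 / (2 * M)"])
    show "C > 0" "1 / (2 * M) > 0" using C M(1) by auto
    fix x m :: "real^'a" and t
    assume H: "norm (x - \<alpha>) \<le> 1" "t \<le> 1 / (2 * M)" "reaches F t x m"
    then have "t \<ge> 0" by (simp add: reaches_def)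
    then have "M * t \<le> C * t" using C(1) by (intro mult_right_mono)
    then show "norm (m - x) \<le> C * t" using main[OF H] by linarith
    have "norm \<zeta> * L * (norm (x - \<alpha>) + M * t) \<le> C * (norm (x - \<alpha>) + t)"
      using mult_right_mono[OF C(2) norm_ge_zero[of "x - \<alpha>"]] mult_right_mono[OF C(3) \<open>t \<ge> 0\<close>]
      by (simp add: distrib_left mult.assoc)
    then have "t * (hamiltonian F \<alpha> \<zeta> - C * (norm (x - \<alpha>) + t)) \<le>
        t * (hamiltonian F \<alpha> \<zeta> - norm \<zeta> * L * (norm (x - \<alpha>) + M * t))"
      using \<open>t \<ge> 0\<close> by (intro mult_left_mono) auto
    then show "t * (hamiltonian F \<alpha> \<zeta> - C * (norm (x - \<alpha>) + t)) \<le> \<zeta> \<bullet> (m - x)"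
      using main[OF H] by linarith
  qed
qed

subsection \<open>Trajectories with prescribed initial velocity\<close>

text \<open>Let \<open>p\<close> and \<open>q\<close> be the projections of \<open>v\<close> on
  \<open>A\<close> and \<open>B\<close>, and \<open>d = norm (v - p)\<close>. A point
  \<open>u\<close> of \<open>A\<close> within \<open>e\<close> of \<open>q\<close> satisfies
  \<open>norm (v - u) \<le> d + 2 * e\<close>, while the obtuse angle at \<open>p\<close> gives
  \<open>(norm (u - p))\<^sup>2 + d\<^sup>2 \<le> (norm (v - u))\<^sup>2\<close>. Subtraction bounds
  \<open>norm (u - p)\<close>.\<close>

lemma closest_point_perturbation:
  fixes v :: "'a::euclidean_space"
  assumes A: "convex A" "closed A" "A \<noteq> {}" and B: "closed B" "B \<noteq> {}"
    and BA: "\<And>b. b \<in> B \<Longrightarrow> \<exists>a\<in>A. norm (b - a) \<le> e"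
    and AB: "\<And>a. a \<in> A \<Longrightarrow> \<exists>b\<in>B. norm (a - b) \<le> e"
  shows "norm (closest_point B v - closest_point A v) \<le>
    e + sqrt (4 * e * norm (v - closest_point A v) + 4 * e\<^sup>2)"
proof -
  define p where "p = closest_point A v"
  define q where "q = closest_point B v"
  define d where "d = norm (v - p)"
  have pq: "p \<in> A" "q \<in> B" using A B closest_point_in_set unfolding p_def q_def by blast+
  obtain u where u: "u \<in> A" "norm (q - u) \<le> e" using BA pq by blast
  obtain w where w: "w \<in> B" "norm (p - w) \<le> e" using AB pq by blast
  have "e \<ge> 0" using u(2) norm_ge_zero order_trans by blast
  have "norm (v - q) \<le> norm (v - w)"
    using closest_point_le[OF B(1) w(1), of v] by (simp add: q_def dist_norm)
  also have "\<dots> \<le> d + e"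
    using norm_triangle_ineq[of "v - p" "p - w"] w(2) by (simp add: d_def)
  finally have "norm (v - u) \<le> d + 2 * e"
    using norm_triangle_ineq[of "v - q" "q - u"] u(2) by simp
  then have "(norm (v - u))\<^sup>2 \<le> (d + 2 * e)\<^sup>2" by (intro power_mono) auto
  moreover have "(v - p) \<bullet> (u - p) \<le> 0"
    using closest_point_dot[OF A(1,2) u(1)] by (simp add: p_def)
  then have "(norm (u - p))\<^sup>2 + d\<^sup>2 \<le> (norm (v - u))\<^sup>2"
    unfolding d_def power2_norm_eq_inner by (simp add: inner_diff_left inner_diff_right inner_commute)
  ultimately have "(norm (u - p))\<^sup>2 \<le> 4 * e * d + 4 * e\<^sup>2"
    by (simp add: power2_eq_square algebra_simps)
  then have "norm (u - p) \<le> sqrt (4 * e * d + 4 * e\<^sup>2)" by (rule real_le_rsqrt)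
  then have "norm (q - p) \<le> e + sqrt (4 * e * d + 4 * e\<^sup>2)"
    using norm_triangle_ineq[of "q - u" "u - p"] u(2) by simp
  then show ?thesis by (simp add: p_def q_def d_def)
qed

text \<open>Near \<open>x\<close> the values of \<open>F\<close> are within Hausdorff distance
  \<open>L * norm (y - x)\<close>, which serves as the \<open>e\<close> of the perturbation bound.
  The resulting modulus contains a square root, so the selection is fed to Peano's theorem rather
  than to Picard's.\<close>

lemma continuous_on_closest_point_selection:
  assumes "F1 F" "F2 F"
  shows "continuous_on UNIV (\<lambda>x. closest_point (F x) v)"
proof -
  let ?f = "\<lambda>x. closest_point (F x) v"
  have F: "convex (F x)" "closed (F x)" "F x \<noteq> {}" for x
    using assms(1) compact_imp_closed by (auto simp: F1_def)
  have "isCont ?f x" for x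
  proof -
    obtain L where L: "L \<ge> 0" "\<And>y z v. y \<in> cball x 1 \<Longrightarrow> z \<in> cball x 1 \<Longrightarrow> v \<in> F y \<Longrightarrow>
      \<exists>w\<in>F z. norm (v - w) \<le> L * norm (z - y)"
      using F2_local[OF assms(2), of x 1] by blast
    define g where "g y = (let e = L * norm (y - x) in e + sqrt (4 * e * norm (v - ?f x) + 4 * e\<^sup>2))" for y
    have "\<forall>\<^sub>F y in at x. norm (?f y - ?f x) \<le> g y"
      unfolding eventually_at
    proof (intro exI[of _ 1] conjI ballI impI)
      fix y assume y: "y \<noteq> x \<and> dist y x < 1"
      have "norm (?f y - ?f x) \<le> L * norm (y - x) +
          sqrt (4 * (L * norm (y - x)) * norm (v - ?f x) + 4 * (L * norm (y - x))\<^sup>2)"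
      proof (rule closest_point_perturbation[OF F F(2,3)])
        show "\<exists>a\<in>F x. norm (b - a) \<le> L * norm (y - x)" if "b \<in> F y" for b
          using L(2)[of y x b] that y by (simp add: dist_commute norm_minus_commute)
        show "\<exists>b\<in>F y. norm (a - b) \<le> L * norm (y - x)" if "a \<in> F x" for a
          using L(2)[of x y a] that y by (simp add: dist_commute)
      qed
      then show "norm (?f y - ?f x) \<le> g y" by (simp add: g_def Let_def)
    qed simp
    moreover have "(g \<longlongrightarrow> 0) (at x)"
      unfolding g_def Let_def by (auto intro!: tendsto_eq_intros)
    ultimately have "((\<lambda>y. ?f y - ?f x) \<longlongrightarrow> 0) (at x)" by (rule Lim_null_comparison)
    then show ?thesis by (simp add: isCont_def LIM_zero_iff)
  qed
  then show ?thesis by (simp add: continuous_on_eq_continuous_at)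
qed

text \<open>The selection of the point of \<open>F x\<close> nearest to \<open>v\<close> takes the
  value \<open>v\<close> at \<alpha>; a solution of the corresponding differential equation is a
  trajectory whose derivative at time 0 is \<open>v\<close>.\<close>

lemma reaches_initial_velocity:
  assumes "F1 F" "F2 F" "F3 F" "v \<in> F \<alpha>" "e > 0"
  obtains d where "d > 0"
    "\<And>t. 0 < t \<Longrightarrow> t < d \<Longrightarrow> \<exists>x. reaches F t \<alpha> x \<and> norm (x - \<alpha> - t *\<^sub>R v) \<le> e * t"
proof -
  obtain M where M: "M > 0" "\<And>x v. norm (x - \<alpha>) \<le> 1 \<Longrightarrow> v \<in> F x \<Longrightarrow> norm v \<le> M"
    using F3_local[OF assms(3), of 1 \<alpha>] by auto
  have F: "closed (F x)" "F x \<noteq> {}" for x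
    using assms(1) compact_imp_closed by (auto simp: F1_def)
  \<comment> \<open>Composing with the projection on a ball around \<alpha> makes the selection
    bounded on the whole space, as \<open>peano_existence\<close> requires.\<close>
  define P where "P = closest_point (cball \<alpha> 1)"
  define f where "f y = closest_point (F (P y)) v" for y
  have fin: "f y \<in> F (P y)" for y unfolding f_def using F by (intro closest_point_in_set)
  have P: "norm (P y - \<alpha>) \<le> 1" for y
    using closest_point_in_set[of "cball \<alpha> 1" y] by (simp add: P_def dist_norm norm_minus_commute)
  have Pid: "P y = y" if "norm (y - \<alpha>) \<le> 1" for y
    unfolding P_def using that by (intro closest_point_self) (simp add: dist_norm norm_minus_commute)
  have "continuous_on UNIV P"
    unfolding P_def by (intro continuous_on_closest_point) auto
  then have "continuous_on UNIV f"
    unfolding f_def by (rule continuous_on_compose2[OF continuous_on_closest_point_selection[OF assms(1,2)]]) simp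
  moreover have "norm (f y) \<le> M" for y using M(2) P fin by blast
  \<comment> \<open>With speed at most \<open>M\<close> the solution stays within distance 1 of
    \<alpha> up to this time, so \<open>P\<close> is the identity along it and the velocities lie in
    \<open>F (x t)\<close>.\<close>
  moreover define T where "T = 1 / M"
  have "T > 0" using M(1) by (simp add: T_def)
  ultimately obtain x where x: "x 0 = \<alpha>"
    "\<And>t. t \<in> {0..T} \<Longrightarrow> (x has_vector_derivative f (x t)) (at t within {0..T})"
    "\<And>s t. s \<in> {0..T} \<Longrightarrow> t \<in> {0..T} \<Longrightarrow> norm (x s - x t) \<le> M * \<bar>s - t\<bar>"
    using peano_existence[of f M T \<alpha>] by (metis less_imp_le)
  have "f (x t) \<in> F (x t)" if "t \<in> {0..T}" for t
  proof -
    have "norm (x t - \<alpha>) \<le> M * t" using x(3)[OF that, of 0] x(1) that by auto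
    also have "\<dots> \<le> M * T" using that M(1) by simp
    also have "\<dots> = 1" using M(1) by (simp add: T_def)
    finally have "P (x t) = x t" by (rule Pid)
    then show ?thesis using fin[of "x t"] by simp
  qed
  then have "AE t\<in>{0..T} in lebesgue. \<exists>v\<in>F (x t). (x has_vector_derivative v) (at t within {0..T})"
    using x(2) by (intro AE_I2) blast
  moreover have "abs_continuous_on {0..T} x"
    using x(3) by (rule lipschitz_imp_abs_continuous_on)
  ultimately have traj: "trajectory_on F {0..T} x" by (simp add: trajectory_on_def)
  have "f \<alpha> = v" using Pid[of \<alpha>] assms(4) by (simp add: f_def closest_point_self)
  then have "(x has_vector_derivative v) (at 0 within {0..T})"
    using x(2)[of 0] x(1) \<open>T > 0\<close> by simp
  then obtain d where d: "d > 0" "\<forall>s\<in>{0..T}. norm (s - 0) < d \<longrightarrow>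
      norm (x s - x 0 - (s - 0) *\<^sub>R v) \<le> e * norm (s - 0)"
    using \<open>e > 0\<close> unfolding has_vector_derivative_def has_derivative_within_alt by blast
  show thesis
  proof (rule that[of "min d T"])
    show "min d T > 0" using d(1) \<open>T > 0\<close> by simp
    fix t assume t: "0 < t" "t < min d T"
    have "trajectory_on F {0..t} x"
      by (rule trajectory_on_subset[OF traj]) (use t in auto)
    then have "reaches F t \<alpha> (x t)" using t x(1) unfolding reaches_def by auto
    moreover have "norm (x t - \<alpha> - t *\<^sub>R v) \<le> e * t" using d(2) t x(1) by auto
    ultimately show "\<exists>y. reaches F t \<alpha> y \<and> norm (y - \<alpha> - t *\<^sub>R v) \<le> e * t" by blast
  qed
qed

subsection \<open>The singular subdifferential\<close>

lemma F1_reflect: "F1 F \<Longrightarrow> F1 (\<lambda>x. uminus ` F x)"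
  by (auto simp: F1_def compact_negations convex_negations)

lemma F2_reflect:
  assumes "F2 F"
  shows "F2 (\<lambda>x. uminus ` F x)"
  unfolding F2_def
proof (intro allI impI)
  fix K :: "(real^'a) set" assume "compact K"
  then obtain L where L: "\<And>x y. x \<in> K \<Longrightarrow> y \<in> K \<Longrightarrow>
      F x \<subseteq> {v + (L * norm (y - x)) *\<^sub>R b | v b. v \<in> F y \<and> b \<in> cball 0 1}"
    using assms unfolding F2_def by meson
  show "\<exists>L. \<forall>x\<in>K. \<forall>y\<in>K. uminus ` F x \<subseteq>
      {v + (L * norm (y - x)) *\<^sub>R b | v b. v \<in> uminus ` F y \<and> b \<in> cball 0 1}"
  proof (intro exI ballI subsetI)
    fix x y u assume "x \<in> K" "y \<in> K" "u \<in> uminus ` F x"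
    then obtain v b where "v \<in> F y" "b \<in> cball 0 1" "- u = v + (L * norm (y - x)) *\<^sub>R b"
      using L[of x y] by (auto simp: subset_eq)
    then have "u = - v + (L * norm (y - x)) *\<^sub>R (- b)" "- v \<in> uminus ` F y" "- b \<in> cball 0 1"
      by (auto simp: minus_equation_iff[of u])
    then show "u \<in> {v + (L * norm (y - x)) *\<^sub>R b | v b. v \<in> uminus ` F y \<and> b \<in> cball 0 1}"
      by blast
  qed
qed

lemma F3_reflect: "F3 F \<Longrightarrow> F3 (\<lambda>x. uminus ` F x)"
  by (simp add: F3_def)

text \<open>The sign passes from the velocity to the covector; this is the origin of
  \<open>- \<theta>\<close> in the condition at \<beta>.\<close>

lemma hamiltonian_reflect: "hamiltonian (\<lambda>x. uminus ` F x) x p = hamiltonian F x (- p)"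
  by (simp add: hamiltonian_def image_image)

section \<open>Vanishing of the Hamiltonian on horizontal normals\<close>

text \<open>The normality inequality is taken with the second endpoint frozen and with the sum norm,
  for a general \<open>F\<close>, so that the lemma serves \<alpha> directly and \<beta> after time
  reversal. For \<open>\<ge> 0\<close>, a point near \<open>\<alpha> - t *\<^sub>R v\<close> with
  \<open>v\<close> minimizing has minimal time at most \<open>r + t\<close>. For
  \<open>\<le> 0\<close>, the end \<open>m\<close> of a short initial arc from \<alpha> has minimal
  time at most \<open>r\<close>.\<close>

lemma hamiltonian_eq_0_of_normal:
  assumes F: "F1 F" "F2 F" "F3 F"
    and T: "bilateral_min_time F (\<alpha>, \<beta>) = ereal r" and "0 < r"
    and normal: "\<And>e. e > 0 \<Longrightarrow> \<exists>d>0. \<forall>x \<mu>. bilateral_min_time F (x, \<beta>) \<le> ereal \<mu> \<longrightarrow>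
      norm (x - \<alpha>) + \<bar>\<mu> - r\<bar> < d \<longrightarrow> \<zeta> \<bullet> (x - \<alpha>) \<le> e * (norm (x - \<alpha>) + \<bar>\<mu> - r\<bar>)"
  shows "hamiltonian F \<alpha> \<zeta> = 0"
proof (rule antisym)
  obtain v where v: "v \<in> F \<alpha>" "hamiltonian F \<alpha> \<zeta> = v \<bullet> \<zeta>"
    using hamiltonian_is_min[OF F(1)] by blast
  \<comment> \<open>\<open>norm \<zeta>\<close> comes from the error \<open>e * t\<close> in the
    position of \<open>x\<close>, and \<open>norm v + 2\<close> from
    \<open>norm (x - \<alpha>) + t \<le> (norm v + 2) * t\<close>, where \<open>e < 1\<close> is
    used.\<close>
  have "- (v \<bullet> \<zeta>) \<le> e * (norm \<zeta> + norm v + 2)" if e: "0 < e" "e < 1" for e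
  proof -
    obtain d where d: "d > 0" "\<And>x \<mu>. bilateral_min_time F (x, \<beta>) \<le> ereal \<mu> \<Longrightarrow>
      norm (x - \<alpha>) + \<bar>\<mu> - r\<bar> < d \<Longrightarrow> \<zeta> \<bullet> (x - \<alpha>) \<le> e * (norm (x - \<alpha>) + \<bar>\<mu> - r\<bar>)"
      using normal[OF e(1)] by blast
    \<comment> \<open>An arc of \<open>- F\<close> that leaves \<alpha> with velocity
      \<open>- v\<close> is, read backwards, an arc of \<open>F\<close> that arrives at \<alpha>
      with velocity \<open>v\<close>.\<close>
    have "- v \<in> uminus ` F \<alpha>" using v(1) by blast
    then obtain d' where d': "d' > 0" "\<And>t. 0 < t \<Longrightarrow> t < d' \<Longrightarrow>
      \<exists>x. reaches (\<lambda>x. uminus ` F x) t \<alpha> x \<and> norm (x - \<alpha> - t *\<^sub>R (- v)) \<le> e * t"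
      using reaches_initial_velocity[OF F1_reflect F2_reflect F3_reflect, OF F _ e(1), of "- v" \<alpha>]
      by blast
    define t where "t = min (d' / 2) (d / (2 * (norm v + 2)))"
    have vp: "norm v + 2 > 0" by (simp add: add_nonneg_pos)
    have t: "0 < t" "t < d'" "(norm v + 2) * t < d"
    proof -
      show "0 < t" "t < d'" using d(1) d'(1) vp by (auto simp: t_def)
      have "(norm v + 2) * t \<le> (norm v + 2) * (d / (2 * (norm v + 2)))"
        using vp by (intro mult_left_mono) (auto simp: t_def)
      also have "\<dots> = d / 2" using vp by (simp add: field_simps)
      finally show "(norm v + 2) * t < d" using d(1) by simp
    qed
    obtain x where x: "reaches F t x \<alpha>" "norm (x - \<alpha> + t *\<^sub>R v) \<le> e * t"
      using d'(2)[OF t(1,2)] by (auto simp: reaches_reflect_iff)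
    have le: "bilateral_min_time F (x, \<beta>) \<le> ereal (r + t)"
      using bilateral_min_time_triangle[OF x(1), of \<beta> r] T by simp
    have "norm (x - \<alpha>) \<le> norm (x - \<alpha> + t *\<^sub>R v) + norm (t *\<^sub>R v)"
      using norm_triangle_ineq4[of "x - \<alpha> + t *\<^sub>R v" "t *\<^sub>R v"] by simp
    also have "\<dots> \<le> (norm v + 1) * t"
    proof -
      have "e * t \<le> t" using t(1) e by simp
      then have "norm (x - \<alpha> + t *\<^sub>R v) \<le> t" using x(2) by linarith
      then show ?thesis using t(1) by (simp add: algebra_simps)
    qed
    finally have nx: "norm (x - \<alpha>) + t \<le> (norm v + 2) * t" by (simp add: algebra_simps)
    then have "\<zeta> \<bullet> (x - \<alpha>) \<le> e * (norm (x - \<alpha>) + t)"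
      using d(2)[OF le] t by simp
    also have "\<dots> \<le> e * ((norm v + 2) * t)" using nx e by (intro mult_left_mono) auto
    finally have 1: "\<zeta> \<bullet> (x - \<alpha>) \<le> e * ((norm v + 2) * t)" .
    have "- (\<zeta> \<bullet> (x - \<alpha> + t *\<^sub>R v)) \<le> norm \<zeta> * norm (x - \<alpha> + t *\<^sub>R v)"
      using norm_cauchy_schwarz[of "- \<zeta>" "x - \<alpha> + t *\<^sub>R v"] by simp
    also have "\<dots> \<le> norm \<zeta> * (e * t)" using x(2) by (rule mult_left_mono) simp
    finally have "- (t * (\<zeta> \<bullet> v)) \<le> norm \<zeta> * (e * t) + \<zeta> \<bullet> (x - \<alpha>)"
      by (simp add: inner_add_right)
    with 1 have "t * (- (v \<bullet> \<zeta>)) \<le> t * (e * (norm \<zeta> + norm v + 2))"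
      by (simp add: algebra_simps inner_commute)
    then show ?thesis by (rule mult_left_le_imp_le[OF _ t(1)])
  qed
  note bound = this
  show "0 \<le> hamiltonian F \<alpha> \<zeta>"
  proof (rule ccontr)
    assume "\<not> 0 \<le> hamiltonian F \<alpha> \<zeta>"
    then have neg: "- (v \<bullet> \<zeta>) > 0" using v by simp
    define K where "K = norm \<zeta> + norm v + 2"
    have "K > 0" by (simp add: K_def add_nonneg_pos)
    \<comment> \<open>This choice makes \<open>e * K\<close> at most half of the positive number
      \<open>- (v \<bullet> \<zeta>)\<close>, contradicting \<open>bound\<close>; the 1/2 keeps
      \<open>e\<close> below 1.\<close>
    define e where "e = min (1 / 2) (- (v \<bullet> \<zeta>) / (2 * K))"
    have "e > 0" "e < 1" using neg \<open>K > 0\<close> by (auto simp: e_def divide_neg_pos)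
    then have "- (v \<bullet> \<zeta>) \<le> e * K" using bound K_def by simp
    also have "\<dots> \<le> (- (v \<bullet> \<zeta>) / (2 * K)) * K"
      using \<open>K > 0\<close> by (intro mult_right_mono) (auto simp: e_def)
    also have "\<dots> = - (v \<bullet> \<zeta>) / 2" using \<open>K > 0\<close> by simp
    finally show False using neg by simp
  qed
  obtain C d0 where C: "C > 0" "d0 > 0"
    "\<And>x t m. norm (x - \<alpha>) \<le> 1 \<Longrightarrow> t \<le> d0 \<Longrightarrow> reaches F t x m \<Longrightarrow> norm (m - x) \<le> C * t"
    "\<And>x t m. norm (x - \<alpha>) \<le> 1 \<Longrightarrow> t \<le> d0 \<Longrightarrow> reaches F t x m \<Longrightarrow>
      t * (hamiltonian F \<alpha> \<zeta> - C * (norm (x - \<alpha>) + t)) \<le> \<zeta> \<bullet> (m - x)"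
    using reaches_estimate[OF F, of \<alpha> \<zeta>] by blast
  show "hamiltonian F \<alpha> \<zeta> \<le> 0"
  proof (rule field_le_epsilon)
    fix e' :: real assume "e' > 0"
    \<comment> \<open>Half of \<open>e'\<close> covers the normality error \<open>e * C\<close>, the
      other half the second-order term \<open>C * t\<close> with \<open>t \<le> e\<close>.\<close>
    define e where "e = e' / (2 * C)"
    have "e > 0" using \<open>e' > 0\<close> C(1) by (simp add: e_def)
    obtain d where d: "d > 0" "\<And>x \<mu>. bilateral_min_time F (x, \<beta>) \<le> ereal \<mu> \<Longrightarrow>
      norm (x - \<alpha>) + \<bar>\<mu> - r\<bar> < d \<Longrightarrow> \<zeta> \<bullet> (x - \<alpha>) \<le> e * (norm (x - \<alpha>) + \<bar>\<mu> - r\<bar>)"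
      using normal[OF \<open>e > 0\<close>] by blast
    define t where "t = min (min r d0) (min e (d / (2 * C)))"
    have t: "0 < t" "t \<le> r" "t \<le> d0" "t \<le> e" "C * t < d"
    proof -
      show "0 < t" "t \<le> r" "t \<le> d0" "t \<le> e"
        using \<open>0 < r\<close> C(1,2) \<open>e > 0\<close> d(1) by (auto simp: t_def)
      have "C * t \<le> C * (d / (2 * C))" using C(1) by (intro mult_left_mono) (auto simp: t_def)
      also have "\<dots> = d / 2" using C(1) by simp
      finally show "C * t < d" using d(1) by simp
    qed
    \<comment> \<open>A duration \<open>s\<close> with \<open>r \<le> s < r + t\<close> leaves less
      than \<open>r\<close> after an arc of length \<open>t\<close> is cut off, so \<open>m\<close>
      may be tested at the unchanged height \<open>r\<close>. The choice \<open>t \<le> r\<close>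
      makes the cut possible.\<close>
    have "bilateral_min_time F (\<alpha>, \<beta>) < ereal (r + t)" using T t(1) by simp
    then obtain s where s: "s < r + t" "reaches F s \<alpha> \<beta>"
      by (rule reaches_of_bilateral_min_time_less)
    have "r \<le> s" using bilateral_min_time_le_reaches[OF s(2)] T by simp
    then obtain m where m: "reaches F t \<alpha> m" "reaches F (s - t) m \<beta>"
      using reaches_split[OF s(2), of t] t by auto
    have "bilateral_min_time F (m, \<beta>) \<le> ereal r"
      using bilateral_min_time_le_reaches[OF m(2)] s(1)
      by (elim order_trans) simp
    moreover have nm: "norm (m - \<alpha>) \<le> C * t" using C(3)[of \<alpha> t m] m(1) t by simp
    ultimately have "\<zeta> \<bullet> (m - \<alpha>) \<le> e * norm (m - \<alpha>)"
      using d(2)[of m r] t by simp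
    also have "\<dots> \<le> e * (C * t)" using nm \<open>e > 0\<close> by simp
    finally have "t * (hamiltonian F \<alpha> \<zeta> - C * t) \<le> t * (e * C)"
      using C(4)[of \<alpha> t m] m(1) t by (simp add: algebra_simps)
    then have "hamiltonian F \<alpha> \<zeta> \<le> e * C + C * t" using t(1) by simp
    also have "\<dots> \<le> e * C + C * e" using t(4) C(1) by simp
    also have "\<dots> = e'" using C(1) by (simp add: e_def)
    finally show "hamiltonian F \<alpha> \<zeta> \<le> 0 + e'" by simp
  qed
qed

section \<open>From normals of the reachable set to horizontal normals of the epigraph\<close>

text \<open>For a point above level \<open>r\<close>, removing the excess duration
  \<open>s - r\<close> at the start replaces \<open>(x, y)\<close> by \<open>(m, y)\<close> in the
  reachable set, where normality applies. Returning from \<open>m\<close> to \<open>x\<close> costs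
  only a quadratic error, because \<open>hamiltonian F \<alpha> \<zeta> \<ge> 0\<close> leaves no
  negative linear term.\<close>

lemma normal_epi_of_normal_reach_set:
  assumes F: "F1 F" "F2 F" "F3 F"
    and T: "bilateral_min_time F (\<alpha>, \<beta>) = ereal r" and "0 < r"
    and normal: "(\<zeta>, \<theta>) \<in> frechet_normal_cone (reach_set F r) (\<alpha>, \<beta>)"
    and h: "hamiltonian F \<alpha> \<zeta> \<ge> 0"
  shows "((\<zeta>, \<theta>), 0) \<in> frechet_normal_cone (epi (bilateral_min_time F)) ((\<alpha>, \<beta>), r)"
  unfolding frechet_normal_cone_def
proof (intro CollectI allI impI)
  fix e :: real assume "e > 0"
  obtain C d0 where C: "C > 0" "d0 > 0"
    "\<And>x t m. norm (x - \<alpha>) \<le> 1 \<Longrightarrow> t \<le> d0 \<Longrightarrow> reaches F t x m \<Longrightarrow> norm (m - x) \<le> C * t"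
    "\<And>x t m. norm (x - \<alpha>) \<le> 1 \<Longrightarrow> t \<le> d0 \<Longrightarrow> reaches F t x m \<Longrightarrow>
      t * (hamiltonian F \<alpha> \<zeta> - C * (norm (x - \<alpha>) + t)) \<le> \<zeta> \<bullet> (m - x)"
    using reaches_estimate[OF F, of \<alpha> \<zeta>] by blast
  \<comment> \<open>The shifted point \<open>(m, y)\<close> is within \<open>(1 + 2 * C) * D\<close>
    of \<open>(\<alpha>, \<beta>)\<close>, so \<eta> leaves an error of \<open>e / 2 * D\<close>
    there.\<close>
  define \<eta> where "\<eta> = e / (2 * (1 + 2 * C))"
  have \<eta>: "\<eta> > 0" "\<eta> * (1 + 2 * C) = e / 2" "\<eta> \<le> e"
  proof -
    show "\<eta> > 0" using \<open>e > 0\<close> C(1) by (simp add: \<eta>_def)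
    show *: "\<eta> * (1 + 2 * C) = e / 2" using C(1) by (simp add: \<eta>_def field_simps)
    have "\<eta> * 1 \<le> \<eta> * (1 + 2 * C)" using \<open>\<eta> > 0\<close> C(1) by (intro mult_left_mono) auto
    then show "\<eta> \<le> e" using * \<open>e > 0\<close> by simp
  qed
  obtain d1 where d1: "d1 > 0" "\<And>z. z \<in> reach_set F r \<Longrightarrow> norm (z - (\<alpha>, \<beta>)) < d1 \<Longrightarrow>
      (\<zeta>, \<theta>) \<bullet> (z - (\<alpha>, \<beta>)) \<le> \<eta> * norm (z - (\<alpha>, \<beta>))"
    using normal \<eta>(1) unfolding frechet_normal_cone_def by blast
  \<comment> \<open>In order: \<open>x\<close> stays within 1 of \<alpha>; the cut length, at most
    \<open>2 * D\<close>, stays in the range of the arc estimate; \<open>(m, y)\<close> stays within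
    \<open>d1\<close>; the quadratic error \<open>6 * C * D * D\<close> is at most
    \<open>e / 2 * D\<close>.\<close>
  define d where "d = min (min 1 (d0 / 2)) (min (d1 / (1 + 2 * C)) (e / (12 * C)))"
  have d: "d > 0" "d \<le> 1" "2 * d \<le> d0" "(1 + 2 * C) * d \<le> d1" "6 * C * d \<le> e / 2" "d \<le> d1"
  proof -
    show *: "d > 0" "d \<le> 1" "2 * d \<le> d0" using C \<open>e > 0\<close> d1(1) by (auto simp: d_def)
    have "(1 + 2 * C) * d \<le> (1 + 2 * C) * (d1 / (1 + 2 * C))"
      using C(1) by (intro mult_left_mono) (auto simp: d_def)
    then show **: "(1 + 2 * C) * d \<le> d1" using C(1) by simp
    have "6 * C * d \<le> 6 * C * (e / (12 * C))"
      using C(1) by (intro mult_left_mono) (auto simp: d_def)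
    then show "6 * C * d \<le> e / 2" using C(1) by simp
    have "1 * d \<le> (1 + 2 * C) * d" using * C(1) by (intro mult_right_mono) auto
    then show "d \<le> d1" using ** by simp
  qed
  show "\<exists>d>0. \<forall>z\<in>epi (bilateral_min_time F). norm (z - ((\<alpha>, \<beta>), r)) < d \<longrightarrow>
      ((\<zeta>, \<theta>), 0) \<bullet> (z - ((\<alpha>, \<beta>), r)) \<le> e * norm (z - ((\<alpha>, \<beta>), r))"
  proof (intro exI conjI ballI impI)
    show "d > 0" by fact
    fix z assume z: "z \<in> epi (bilateral_min_time F)" "norm (z - ((\<alpha>, \<beta>), r)) < d"
    obtain x y \<mu> where xy: "z = ((x, y), \<mu>)" by (metis surj_pair)
    define D where "D = norm (z - ((\<alpha>, \<beta>), r))"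
    have le: "bilateral_min_time F (x, y) \<le> ereal \<mu>" using z(1) by (simp add: epi_def xy)
    have D: "D \<ge> 0" "D < d" "norm ((x, y) - (\<alpha>, \<beta>)) \<le> D" "norm (x - \<alpha>) \<le> D" "\<bar>\<mu> - r\<bar> \<le> D"
    proof -
      show "D \<ge> 0" "D < d" using z(2) by (auto simp: D_def)
      show *: "norm ((x, y) - (\<alpha>, \<beta>)) \<le> D"
        using norm_fst_le[of "(x, y) - (\<alpha>, \<beta>)" "\<mu> - r"] by (simp add: D_def xy)
      show "norm (x - \<alpha>) \<le> D"
        using norm_fst_le[of "x - \<alpha>" "y - \<beta>"] * by simp
      show "\<bar>\<mu> - r\<bar> \<le> D"
        using norm_snd_le[of "\<mu> - r" "(x, y) - (\<alpha>, \<beta>)"] by (simp add: D_def xy)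
    qed
    have "(\<zeta>, \<theta>) \<bullet> ((x, y) - (\<alpha>, \<beta>)) \<le> e * D"
    proof (cases "bilateral_min_time F (x, y) \<le> ereal r")
      case True
      then have "(x, y) \<in> reach_set F r" by (simp add: reach_set_def)
      then have "(\<zeta>, \<theta>) \<bullet> ((x, y) - (\<alpha>, \<beta>)) \<le> \<eta> * norm ((x, y) - (\<alpha>, \<beta>))"
        using D d by (intro d1(2)) auto
      also have "\<dots> \<le> e * D" using \<eta> D(1,3) by (intro mult_mono) auto
      finally show ?thesis .
    next
      case False
      then have "ereal r < ereal \<mu>" using le by (metis less_le_trans not_le)
      then have "r < \<mu>" by simp
      \<comment> \<open>A duration strictly below a bound needs slack over \<mu>, since the minimal
        time may equal \<mu>. Doubling the excess keeps the cut length of order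
        \<open>D\<close>.\<close>
      then have "\<mu> < r + 2 * (\<mu> - r)" by simp
      then have "bilateral_min_time F (x, y) < ereal (r + 2 * (\<mu> - r))"
        using le by (metis ereal_less(2) le_less_trans less_ereal.simps(1))
      then obtain s where s: "s < r + 2 * (\<mu> - r)" "reaches F s x y"
        by (rule reaches_of_bilateral_min_time_less)
      have "ereal r < ereal s"
        using False bilateral_min_time_le_reaches[OF s(2)] by (metis less_le_trans not_le)
      then have "r < s" by simp
      define t where "t = s - r"
      have t: "0 < t" "t \<le> 2 * D" using \<open>r < s\<close> s(1) D(5) by (auto simp: t_def)
      obtain m where m: "reaches F t x m" "reaches F r m y"
        using reaches_split[OF s(2), of t] \<open>r < s\<close> \<open>0 < r\<close> by (auto simp: t_def)
      have x1: "norm (x - \<alpha>) \<le> 1" "t \<le> d0" using D d t by auto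
      have "norm (m - x) \<le> C * t" by (rule C(3)[OF x1 m(1)])
      also have "\<dots> \<le> C * (2 * D)" using t C(1) by (intro mult_left_mono) auto
      finally have mx: "norm (m - x) \<le> 2 * C * D" by simp
      have "t * (C * (norm (x - \<alpha>) + t)) \<le> (2 * D) * (C * (D + 2 * D))"
        using t D C(1) by (intro mult_mono add_mono) auto
      then have "t * (C * (norm (x - \<alpha>) + t)) \<le> (6 * C * D) * D" by (simp add: algebra_simps)
      also have "\<dots> \<le> (e / 2) * D"
      proof (rule mult_right_mono)
        have "6 * C * D \<le> 6 * C * d" using D C(1) by (intro mult_left_mono) auto
        then show "6 * C * D \<le> e / 2" using d(5) by simp
      qed fact
      finally have "- (t * (C * (norm (x - \<alpha>) + t))) \<ge> - (e / 2 * D)" by simp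
      moreover have "t * hamiltonian F \<alpha> \<zeta> \<ge> 0" using t h by simp
      ultimately have \<zeta>m: "- (e / 2 * D) \<le> \<zeta> \<bullet> (m - x)"
        using C(4)[OF x1 m(1)] by (simp add: right_diff_distrib)
      \<comment> \<open>Only the first endpoint moves, so the correction involves \<zeta> alone and
        is measured by \<open>\<zeta> \<bullet> (m - x)\<close>.\<close>
      have "(m, y) - (\<alpha>, \<beta>) = (m - x, 0) + ((x, y) - (\<alpha>, \<beta>))" by simp
      then have "norm ((m, y) - (\<alpha>, \<beta>)) \<le> norm (m - x) + D"
        using norm_triangle_ineq[of "(m - x, 0)" "(x, y) - (\<alpha>, \<beta>)"] D(3) by (simp add: norm_Pair)
      then have nm: "norm ((m, y) - (\<alpha>, \<beta>)) \<le> (1 + 2 * C) * D" using mx by (simp add: algebra_simps)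
      also have "\<dots> < (1 + 2 * C) * d" using D C(1) by (intro mult_strict_left_mono) auto
      finally have "norm ((m, y) - (\<alpha>, \<beta>)) < d1" using d(4) by simp
      moreover have "(m, y) \<in> reach_set F r"
        using bilateral_min_time_le_reaches[OF m(2)] by (simp add: reach_set_def)
      ultimately have "(\<zeta>, \<theta>) \<bullet> ((m, y) - (\<alpha>, \<beta>)) \<le> \<eta> * norm ((m, y) - (\<alpha>, \<beta>))"
        by (intro d1(2))
      also have "\<dots> \<le> \<eta> * ((1 + 2 * C) * D)" using nm \<eta>(1) by (intro mult_left_mono) auto
      also have "\<dots> = e / 2 * D" by (simp only: mult.assoc[symmetric] \<eta>(2))
      finally have "\<zeta> \<bullet> (m - \<alpha>) + \<theta> \<bullet> (y - \<beta>) \<le> e / 2 * D" by (simp add: inner_Pair)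
      then have "\<zeta> \<bullet> (x - \<alpha>) + \<theta> \<bullet> (y - \<beta>) \<le> e / 2 * D + e / 2 * D"
        using \<zeta>m unfolding inner_diff_right by linarith
      then show ?thesis by (simp add: inner_Pair mult.commute)
    qed
    then show "((\<zeta>, \<theta>), 0) \<bullet> (z - ((\<alpha>, \<beta>), r)) \<le> e * norm (z - ((\<alpha>, \<beta>), r))"
      by (simp add: xy D_def inner_Pair)
  qed
qed

theorem theorem3p5:
  fixes F :: "real^'n \<Rightarrow> (real^'n) set" and \<alpha> \<beta> :: "real^'n" and r :: real
  assumes "F1 F" and "F2 F" and "F3 F"
    and "bilateral_min_time F (\<alpha>, \<beta>) = ereal r" and "0 < r"
  shows "frechet_singular_subdiff (bilateral_min_time F) (\<alpha>, \<beta>) =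
    frechet_normal_cone (reach_set F r) (\<alpha>, \<beta>) \<inter>
      {(\<zeta>, \<theta>). hamiltonian F \<alpha> \<zeta> = 0 \<and> hamiltonian F \<beta> (- \<theta>) = 0}"
proof (rule set_eqI, rule iffI)
  fix p assume "p \<in> frechet_singular_subdiff (bilateral_min_time F) (\<alpha>, \<beta>)"
  moreover obtain \<zeta> \<theta> where p: "p = (\<zeta>, \<theta>)" by fastforce
  ultimately have "((\<zeta>, \<theta>), 0) \<in> frechet_normal_cone (epi (bilateral_min_time F)) ((\<alpha>, \<beta>), r)"
    using assms(4) by (simp add: frechet_singular_subdiff_def)
  then have cone: "\<exists>d>0. \<forall>z\<in>epi (bilateral_min_time F). norm (z - ((\<alpha>, \<beta>), r)) < d \<longrightarrow>
      ((\<zeta>, \<theta>), 0) \<bullet> (z - ((\<alpha>, \<beta>), r)) \<le> e * norm (z - ((\<alpha>, \<beta>), r))" if "e > 0" for e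
    using that unfolding frechet_normal_cone_def by blast
  have normal: "\<exists>d>0. \<forall>x y \<mu>. bilateral_min_time F (x, y) \<le> ereal \<mu> \<longrightarrow>
      norm ((x - \<alpha>, y - \<beta>), \<mu> - r) < d \<longrightarrow>
      \<zeta> \<bullet> (x - \<alpha>) + \<theta> \<bullet> (y - \<beta>) \<le> e * norm ((x - \<alpha>, y - \<beta>), \<mu> - r)" if e: "e > 0" for e
  proof -
    obtain d where d: "d > 0" "\<And>z. z \<in> epi (bilateral_min_time F) \<Longrightarrow>
      norm (z - ((\<alpha>, \<beta>), r)) < d \<Longrightarrow>
      ((\<zeta>, \<theta>), 0) \<bullet> (z - ((\<alpha>, \<beta>), r)) \<le> e * norm (z - ((\<alpha>, \<beta>), r))"
      using cone[OF e] by blast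
    show ?thesis
    proof (intro exI conjI allI impI)
      fix x y \<mu> assume H: "bilateral_min_time F (x, y) \<le> ereal \<mu>"
        "norm ((x - \<alpha>, y - \<beta>), \<mu> - r) < d"
      then have "((x, y), \<mu>) \<in> epi (bilateral_min_time F)"
        by (auto simp: epi_def)
      from d(2)[OF this] H(2)
      show "\<zeta> \<bullet> (x - \<alpha>) + \<theta> \<bullet> (y - \<beta>) \<le> e * norm ((x - \<alpha>, y - \<beta>), \<mu> - r)"
        by (simp add: inner_Pair)
    qed fact
  qed
  \<comment> \<open>The slice of the epigraph at height \<open>r\<close> is the reachable set; with
    \<open>\<mu> = r\<close> the last coordinate contributes nothing to the norm.\<close>
  have "(\<zeta>, \<theta>) \<in> frechet_normal_cone (reach_set F r) (\<alpha>, \<beta>)"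
    unfolding frechet_normal_cone_def
  proof (intro CollectI allI impI)
    fix e :: real assume "e > 0"
    then obtain d where d: "d > 0" "\<And>x y \<mu>. bilateral_min_time F (x, y) \<le> ereal \<mu> \<Longrightarrow>
      norm ((x - \<alpha>, y - \<beta>), \<mu> - r) < d \<Longrightarrow>
      \<zeta> \<bullet> (x - \<alpha>) + \<theta> \<bullet> (y - \<beta>) \<le> e * norm ((x - \<alpha>, y - \<beta>), \<mu> - r)"
      using normal by blast
    show "\<exists>d>0. \<forall>y\<in>reach_set F r. norm (y - (\<alpha>, \<beta>)) < d \<longrightarrow>
        (\<zeta>, \<theta>) \<bullet> (y - (\<alpha>, \<beta>)) \<le> e * norm (y - (\<alpha>, \<beta>))"
      using d(1) d(2)[of _ _ r] by (intro exI[of _ d]) (auto simp: reach_set_def norm_Pair)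
  qed
  moreover have "hamiltonian F \<alpha> \<zeta> = 0"
  proof (rule hamiltonian_eq_0_of_normal[OF assms])
    fix e :: real assume "e > 0"
    then obtain d where d: "d > 0" "\<And>x y \<mu>. bilateral_min_time F (x, y) \<le> ereal \<mu> \<Longrightarrow>
      norm ((x - \<alpha>, y - \<beta>), \<mu> - r) < d \<Longrightarrow>
      \<zeta> \<bullet> (x - \<alpha>) + \<theta> \<bullet> (y - \<beta>) \<le> e * norm ((x - \<alpha>, y - \<beta>), \<mu> - r)"
      using normal by blast
    show "\<exists>d>0. \<forall>x \<mu>. bilateral_min_time F (x, \<beta>) \<le> ereal \<mu> \<longrightarrow>
      norm (x - \<alpha>) + \<bar>\<mu> - r\<bar> < d \<longrightarrow> \<zeta> \<bullet> (x - \<alpha>) \<le> e * (norm (x - \<alpha>) + \<bar>\<mu> - r\<bar>)"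
    proof (intro exI conjI allI impI)
      fix x \<mu> assume H: "bilateral_min_time F (x, \<beta>) \<le> ereal \<mu>" "norm (x - \<alpha>) + \<bar>\<mu> - r\<bar> < d"
      \<comment> \<open>The Euclidean norm is dominated by the sum norm, both in the smallness
        condition and in the error term.\<close>
      have n: "norm ((x - \<alpha>, \<beta> - \<beta>), \<mu> - r) \<le> norm (x - \<alpha>) + \<bar>\<mu> - r\<bar>"
        using norm_Pair_le[of "(x - \<alpha>, \<beta> - \<beta>)" "\<mu> - r"] by (simp add: norm_Pair)
      then have "\<zeta> \<bullet> (x - \<alpha>) \<le> e * norm ((x - \<alpha>, \<beta> - \<beta>), \<mu> - r)"
        using d(2)[OF H(1)] H(2) by simp
      also have "\<dots> \<le> e * (norm (x - \<alpha>) + \<bar>\<mu> - r\<bar>)"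
        using n \<open>e > 0\<close> by (intro mult_left_mono) auto
      finally show "\<zeta> \<bullet> (x - \<alpha>) \<le> e * (norm (x - \<alpha>) + \<bar>\<mu> - r\<bar>)" .
    qed fact
  qed
  \<comment> \<open>Time reversal exchanges the endpoints and preserves the minimal time, so the
    condition at \<beta> is the one at the initial point for \<open>- F\<close>.\<close>
  moreover have "hamiltonian (\<lambda>x. uminus ` F x) \<beta> \<theta> = 0"
  proof (rule hamiltonian_eq_0_of_normal[where \<beta> = \<alpha> and r = r])
    show "bilateral_min_time (\<lambda>x. uminus ` F x) (\<beta>, \<alpha>) = ereal r"
      using assms(4) by (simp add: bilateral_min_time_reflect)
    fix e :: real assume "e > 0"
    then obtain d where d: "d > 0" "\<And>x y \<mu>. bilateral_min_time F (x, y) \<le> ereal \<mu> \<Longrightarrow>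
      norm ((x - \<alpha>, y - \<beta>), \<mu> - r) < d \<Longrightarrow>
      \<zeta> \<bullet> (x - \<alpha>) + \<theta> \<bullet> (y - \<beta>) \<le> e * norm ((x - \<alpha>, y - \<beta>), \<mu> - r)"
      using normal by blast
    show "\<exists>d>0. \<forall>y \<mu>. bilateral_min_time (\<lambda>x. uminus ` F x) (y, \<alpha>) \<le> ereal \<mu> \<longrightarrow>
      norm (y - \<beta>) + \<bar>\<mu> - r\<bar> < d \<longrightarrow> \<theta> \<bullet> (y - \<beta>) \<le> e * (norm (y - \<beta>) + \<bar>\<mu> - r\<bar>)"
    proof (intro exI conjI allI impI)
      fix y \<mu> assume H: "bilateral_min_time (\<lambda>x. uminus ` F x) (y, \<alpha>) \<le> ereal \<mu>"
        "norm (y - \<beta>) + \<bar>\<mu> - r\<bar> < d"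
      have n: "norm ((\<alpha> - \<alpha>, y - \<beta>), \<mu> - r) \<le> norm (y - \<beta>) + \<bar>\<mu> - r\<bar>"
        using norm_Pair_le[of "(\<alpha> - \<alpha>, y - \<beta>)" "\<mu> - r"] by (simp add: norm_Pair)
      have "bilateral_min_time F (\<alpha>, y) \<le> ereal \<mu>"
        using H(1) by (simp add: bilateral_min_time_reflect)
      from d(2)[OF this] n H(2) have "\<theta> \<bullet> (y - \<beta>) \<le> e * norm ((\<alpha> - \<alpha>, y - \<beta>), \<mu> - r)"
        by simp
      also have "\<dots> \<le> e * (norm (y - \<beta>) + \<bar>\<mu> - r\<bar>)"
        using n \<open>e > 0\<close> by (intro mult_left_mono) auto
      finally show "\<theta> \<bullet> (y - \<beta>) \<le> e * (norm (y - \<beta>) + \<bar>\<mu> - r\<bar>)" .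
    qed fact
  qed (use assms in \<open>auto intro: F1_reflect F2_reflect F3_reflect\<close>)
  ultimately show "p \<in> frechet_normal_cone (reach_set F r) (\<alpha>, \<beta>) \<inter>
      {(\<zeta>, \<theta>). hamiltonian F \<alpha> \<zeta> = 0 \<and> hamiltonian F \<beta> (- \<theta>) = 0}"
    by (simp add: p hamiltonian_reflect)
next
  fix p assume "p \<in> frechet_normal_cone (reach_set F r) (\<alpha>, \<beta>) \<inter>
      {(\<zeta>, \<theta>). hamiltonian F \<alpha> \<zeta> = 0 \<and> hamiltonian F \<beta> (- \<theta>) = 0}"
  then show "p \<in> frechet_singular_subdiff (bilateral_min_time F) (\<alpha>, \<beta>)"
    using normal_epi_of_normal_reach_set[OF assms] assms(4)
    by (auto simp: frechet_singular_subdiff_def)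
qed

end
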